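(* Let $B=\sigma_1^{p_1}\sigma_2^{-q_1}\cdots\sigma_1^{p_n}\sigma_2^{-q_n}$ be an alternating 3-braid, where $n\ge1$ and all $p_i,q_j$ are positive integers, and let $L_B$ be its closure. Assume that $$p_1\ \ge\ \sum_{i=2}^n p_i+\sum_{j=1}^n q_j+6 .$$ Then the Hirasawa--Murasugi conjecture holds for $L_B$. That is, writing $\Delta_{L_B}(t)\doteq\sum_{i=0}^{l-1}(-1)^ia_it^i$ with $a_i\ge0$ and $a_0,a_{l-1}\neq0$, there is an integer $i_0\in\{1,\dots,\lfloor l/2\rfloor+1\}$ such that $$a_0<\dots<a_{i_0-1}=a_{i_0}=\dots=a_{l-i_0}>\dots>a_{l-1},$$ and $$\left\lfloor\frac{|\sigma(L_B)|+1}{2}\right\rfloor\ \ge\ \left\lfloor\frac{l-2(i_0-1)}{2}\right\rfloor .$$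
   Context: $\sigma_1,\sigma_2$ are the standard generators of the braid group on three strands; closures of braids carry the braid orientation. $\Delta$ is the single-variable Alexander polynomial, $\doteq$ means equality up to units $\pm t^k$, and $\sigma(L_B)$ is the link signature. *)

theory Defs
  imports "Jordan_Normal_Form.Char_Poly"
begin

text \<open>
  A braid word is a list of letters; the letter \<open>(i, 1)\<close> stands for \<open>\<sigma>\<^sub>i\<close> and \<open>(i, -1)\<close> for its
  inverse. The word denotes the link obtained as its closure, oriented as a closed braid.
  Letters \<open>\<sigma>\<^sub>i\<close> are taken to be positive crossings. The opposite convention replaces the closure
  by its mirror image, which changes neither the Alexander polynomial (up to units) nor the
  absolute value of the signature.
\<close>

type_synonym braid_word = "(nat \<times> int) list"

definition gen_power :: "nat \<Rightarrow> int \<Rightarrow> braid_word" where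
  "gen_power i k = replicate (nat \<bar>k\<bar>) (i, sgn k)"

definition alternating_3braid :: "nat \<Rightarrow> (nat \<Rightarrow> nat) \<Rightarrow> (nat \<Rightarrow> nat) \<Rightarrow> braid_word" where
  "alternating_3braid n p q =
     concat (map (\<lambda>i. gen_power 1 (int (p i)) @ gen_power 2 (- int (q i))) [1..<Suc n])"

text \<open>
  Seifert's algorithm applied to the closed braid diagram of \<open>w\<close> gives a surface \<open>F\<close> made of
  parallel discs \<open>D\<^sub>1, D\<^sub>2, \<dots>\<close>, stacked along the braid axis with \<open>D\<^bsub>i+1\<^esub>\<close> above \<open>D\<^sub>i\<close> and with the
  strands running counterclockwise along their boundaries, and of one half-twisted band for
  each letter \<open>(i, e)\<close> of \<open>w\<close>, joining \<open>D\<^sub>i\<close> to \<open>D\<^bsub>i+1\<^esub>\<close>. The positive normal of every disc points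
  upwards. \<open>F\<close> is connected, hence a Seifert surface of the closure, iff each of the generators
  \<open>\<sigma>\<^sub>1, \<sigma>\<^sub>2, \<dots>\<close> of the braid group occurs in \<open>w\<close>; the notions below are meant for such words only.

  The homology group \<open>H\<^sub>1(F)\<close> is then free on the loops indexed by the pairs \<open>(a, b)\<close> of consecutive
  occurrences of the same generator \<open>\<sigma>\<^sub>i\<close>: go up through band \<open>a\<close> from \<open>D\<^sub>i\<close> to \<open>D\<^bsub>i+1\<^esub>\<close>, across \<open>D\<^bsub>i+1\<^esub>\<close>
  to band \<open>b\<close>, down through it, and back across \<open>D\<^sub>i\<close>.
\<close>

definition braid_loops :: "braid_word \<Rightarrow> (nat \<times> nat) list" where
  "braid_loops w =
     filter (\<lambda>(a, b). a < b \<and> fst (w ! a) = fst (w ! b) \<and>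
                      (\<forall>c. a < c \<and> c < b \<longrightarrow> fst (w ! c) \<noteq> fst (w ! a)))
       (List.product [0..<length w] [0..<length w])"

text \<open>
  The linking number of the loop \<open>x\<close> with the push-off of the loop \<open>y\<close> in the direction of the
  positive normal of \<open>F\<close>.

  \<^item> A loop runs once through two bands; a band of sign \<open>e\<close> contributes \<open>- e / 2\<close> to its
    self-linking.
  \<^item> Two consecutive loops of the same column share one band, and its sign decides which of the
    two push-offs is linked with the other loop.
  \<^item> For loops of adjacent columns, \<open>x\<close> above \<open>y\<close>, only the chords of the common disc matter. There the
    push-off of \<open>y\<close> passes above \<open>x\<close>, so the two are linked once iff the chords cross, i.e. iff
    the end points interleave. If \<open>x\<close> is below \<open>y\<close>, the push-off of \<open>y\<close> lies entirely above \<open>x\<close>.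
  \<^item> All other pairs of distinct loops are unlinked.
\<close>

definition loop_linking :: "braid_word \<Rightarrow> nat \<times> nat \<Rightarrow> nat \<times> nat \<Rightarrow> int" where
  "loop_linking w x y =
     (case (x, y) of ((a, b), (c, d)) \<Rightarrow>
        let i = fst (w ! a); j = fst (w ! c) in
        if x = y then - ((snd (w ! a) + snd (w ! b)) div 2)
        else if i = j \<and> b = c then (if snd (w ! b) = 1 then 0 else - 1)
        else if i = j \<and> d = a then (if snd (w ! a) = 1 then 1 else 0)
        else if i = Suc j \<and> c < a \<and> a < d \<and> d < b then - 1
        else if i = Suc j \<and> a < c \<and> c < b \<and> b < d then 1
        else 0)"

definition Seifert_matrix :: "braid_word \<Rightarrow> int mat" where
  "Seifert_matrix w =
     (let L = braid_loops w in
      mat (length L) (length L) (\<lambda>(r, s). loop_linking w (L ! r) (L ! s)))"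

text \<open>\<open>det (V - t V\<^sup>T)\<close>; as a link invariant it is defined up to units \<open>\<plusminus> t\<^sup>k\<close> only.\<close>

definition Alexander_polynomial :: "braid_word \<Rightarrow> int poly" where
  "Alexander_polynomial w =
     (let V = Seifert_matrix w in
      det (map_mat (\<lambda>c. [:c:]) V - [:0, 1:] \<cdot>\<^sub>m map_mat (\<lambda>c. [:c:]) (transpose_mat V)))"

text \<open>Equality up to units of \<open>\<int>[t, t\<^sup>-\<^sup>1]\<close>, for elements of \<open>\<int>[t]\<close>.\<close>

definition eq_up_to_units :: "int poly \<Rightarrow> int poly \<Rightarrow> bool"  (infix "\<doteq>" 50) where
  "f \<doteq> g \<longleftrightarrow>
     (\<exists>j k. \<exists>s\<in>{1, -1}. Polynomial.monom 1 j * f = Polynomial.monom s k * g)"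

text \<open>For real symmetric matrices: positive minus negative eigenvalues, with multiplicity.\<close>

definition matrix_signature :: "real mat \<Rightarrow> int" where
  "matrix_signature A =
     (\<Sum>x | eigenvalue A x \<and> x > 0. int (Polynomial.order x (char_poly A))) -
     (\<Sum>x | eigenvalue A x \<and> x < 0. int (Polynomial.order x (char_poly A)))"

definition link_signature :: "braid_word \<Rightarrow> int" where
  "link_signature w =
     (let V = Seifert_matrix w in matrix_signature (map_mat real_of_int (V + transpose_mat V)))"

definition alternating_coeffs :: "int poly \<Rightarrow> nat \<Rightarrow> (nat \<Rightarrow> int) \<Rightarrow> bool" where
  "alternating_coeffs f l a \<longleftrightarrow>
     l \<ge> 1 \<and> (\<forall>i<l. a i \<ge> 0) \<and> a 0 \<noteq> 0 \<and> a (l - 1) \<noteq> 0 \<and>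
     f \<doteq> (\<Sum>i<l. Polynomial.monom ((- 1) ^ i * a i) i)"

definition trapezoidal_at :: "nat \<Rightarrow> nat \<Rightarrow> (nat \<Rightarrow> int) \<Rightarrow> bool" where
  "trapezoidal_at i0 l a \<longleftrightarrow>
     strict_mono_on {0..i0 - 1} a \<and>
     (\<forall>i\<in>{i0 - 1..l - i0}. a i = a (i0 - 1)) \<and>
     strict_antimono_on {l - i0..l - 1} a"

text \<open>
  The pair of \<open>l\<close> and \<open>a\<^sub>0, \<dots>, a\<^bsub>l-1\<^esub>\<close> is determined by the Alexander polynomial. Its existence is
  part of the assertion.
\<close>

definition Hirasawa_Murasugi :: "braid_word \<Rightarrow> bool" where
  "Hirasawa_Murasugi w \<longleftrightarrow>
     (\<exists>l a. alternating_coeffs (Alexander_polynomial w) l a) \<and>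
     (\<forall>l a. alternating_coeffs (Alexander_polynomial w) l a \<longrightarrow>
        (\<exists>i0\<in>{1..l div 2 + 1}.
           trapezoidal_at i0 l a \<and>
           (\<bar>link_signature w\<bar> + 1) div 2 \<ge> (int l - 2 * (int i0 - 1)) div 2))"

end

theory Submission
  imports Defs "Jordan_Normal_Form.Spectral_Radius"
begin

text \<open>
  In the basis of bands, \<open>V - t V\<^sup>T\<close> is the restriction of a form that is lower triangular along the
  word, with entries below the diagonal depending on the columns only. Column operations therefore
  reduce its determinant to a product of \<open>2 \<times> 2\<close> matrices, the Burau matrices. At \<open>t = - s\<close> one gets,
  up to sign, \<open>(1 - s + s\<^sup>2) f(s) = tr \<Pi> - s\<^sup>P - s\<^sup>Q\<close>, where \<open>P\<close> and \<open>Q\<close> count the letters \<open>\<sigma>\<^sub>1\<close> and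
  \<open>\<sigma>\<^sub>2\<^sup>-\<^sup>1\<close>, and \<open>\<Pi>\<close> is a product of the matrices \<open>(1, s; 0, s)\<close> and \<open>(1, 0; 1, s)\<close>.

  A long block \<open>\<sigma>\<^sub>1\<^sup>p\<close> gives \<open>(1 - s) f(s) = X(s) + O(s\<^sup>p)\<close>, where \<open>X\<close> depends on the rest of the word
  only. A recursion along that rest shows that the coefficients of \<open>X\<close> are positive up to its
  degree \<open>d\<close>, and that \<open>Q - 1 \<le> d < p\<close>. Below \<open>p\<close> the coefficients of \<open>f\<close> are the partial sums of
  those of \<open>X\<close>: they increase up to \<open>d\<close> and then stay constant. Since \<open>f\<close> is palindromic, this is the
  trapezoidal shape with \<open>i\<^sub>0 = d + 1\<close>.

  The symmetrized Seifert form is negative definite on the \<open>P - 1\<close> loops of the first column, so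
  the signature is at most \<open>Q - P\<close>; with \<open>Q - 1 \<le> d\<close> this is the required inequality.
\<close>

section \<open>The linking form in terms of bands\<close>

definition alternating_letters :: "braid_word \<Rightarrow> bool" where
  "alternating_letters w \<longleftrightarrow> set w \<subseteq> {(1, 1), (2, - 1)}"

text \<open>The default \<open>length w\<close>, taken when generator \<open>i\<close> does not
  occur, is harmless: in \<open>sum_braid_loops\<close> the coefficient in front of it is then
  zero.\<close>

definition first_position :: "nat \<Rightarrow> braid_word \<Rightarrow> nat" where
  "first_position i w = length (takeWhile (\<lambda>l. fst l \<noteq> i) w)"

lemma first_position_Cons:
  "first_position i (l # w) = (if fst l = i then 0 else Suc (first_position i w))"
  by (simp add: first_position_def)

lemma first_position_iff:
  assumes "i \<in> fst ` set w"
  shows "(b < length w \<and> fst (w ! b) = i \<and> (\<forall>c<b. fst (w ! c) \<noteq> i)) \<longleftrightarrow> b = first_position i w"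
  using assms
proof (induction w arbitrary: b)
  case (Cons l w)
  show ?case
  proof (cases "fst l = i")
    case True
    then show ?thesis by (cases b) (auto simp: first_position_Cons)
  next
    case False
    then have "i \<in> fst ` set w" using Cons.prems by auto
    from Cons.IH[OF this] False show ?thesis
      by (cases b) (auto simp: first_position_Cons All_less_Suc2)
  qed
qed simp

lemma filter_upt_singleton:
  assumes "\<And>i. i < n \<Longrightarrow> P i \<longleftrightarrow> i = k" "k < n"
  shows "filter P [0..<n] = [k]"
proof -
  have "filter P [0..<n] = filter (\<lambda>i. i = k) [0..<n]"
    using assms(1) by (intro filter_cong) auto
  also have "\<dots> = [k]"
    using assms(2)
  proof (induction n)
    case (Suc n)
    have "filter (\<lambda>i. i = k) [0..<n] = []" if "n = k"
      using that by (simp add: filter_empty_conv)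
    then show ?case using Suc by (cases "k = n") auto
  qed simp
  finally show ?thesis .
qed

lemma braid_loops_Nil [simp]: "braid_loops [] = []"
  by (simp add: braid_loops_def)

text \<open>Loops are listed by increasing first entry, so the one loop that a new first letter can
  open stands at the head of the list. The inductions along the word rest on this recursion.\<close>

lemma braid_loops_Cons:
  "braid_loops (l # w) =
     (if fst l \<in> fst ` set w then [(0, Suc (first_position (fst l) w))] else []) @
     map (map_prod Suc Suc) (braid_loops w)"
proof -
  let ?n = "length w"
  let ?P = "\<lambda>w (a, b). a < b \<and> fst (w ! a) = fst (w ! b) \<and>
                      (\<forall>c. a < c \<and> c < b \<longrightarrow> fst (w ! c) \<noteq> fst (w ! a))"
  have upt: "[0..<Suc ?n] = 0 # map Suc [0..<?n]"
    by (simp add: upt_conv_Cons map_Suc_upt del: upt_Suc)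
  have shift: "?P (l # w) (map_prod Suc Suc x) \<longleftrightarrow> ?P w x" for x
  proof (cases x)
    case (Pair a b)
    have "(\<forall>c. Suc a < c \<and> c < Suc b \<longrightarrow> fst ((l # w) ! c) \<noteq> fst (w ! a)) \<longleftrightarrow>
          (\<forall>c. a < c \<and> c < b \<longrightarrow> fst (w ! c) \<noteq> fst (w ! a))" (is "?L \<longleftrightarrow> ?R")
    proof
      assume ?L then show ?R by (metis Suc_less_eq nth_Cons_Suc)
    next
      assume R: ?R
      show ?L
      proof (intro allI impI)
        fix c assume "Suc a < c \<and> c < Suc b"
        then show "fst ((l # w) ! c) \<noteq> fst (w ! a)" using R by (cases c) auto
      qed
    qed
    then show ?thesis using Pair by simp
  qed
  have first: "filter (?P (l # w)) (map (Pair 0) [0..<Suc ?n]) =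
     (if fst l \<in> fst ` set w then [(0, Suc (first_position (fst l) w))] else [])"
  proof -
    have *: "?P (l # w) (0, Suc b) \<longleftrightarrow>
        b < ?n \<and> fst (w ! b) = fst l \<and> (\<forall>c<b. fst (w ! c) \<noteq> fst l)" if "b < ?n" for b
    proof -
      have "(\<forall>c. 0 < c \<and> c < Suc b \<longrightarrow> fst ((l # w) ! c) \<noteq> fst l) \<longleftrightarrow>
            (\<forall>c<b. fst (w ! c) \<noteq> fst l)" (is "?L \<longleftrightarrow> ?R")
      proof
        assume ?L then show ?R by (metis Suc_less_eq nth_Cons_Suc zero_less_Suc)
      next
        assume R: ?R
        show ?L
        proof (intro allI impI)
          fix c assume "0 < c \<and> c < Suc b"
          then show "fst ((l # w) ! c) \<noteq> fst l" using R by (cases c) auto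
        qed
      qed
      then show ?thesis using that by auto
    qed
    have "filter (?P (l # w)) (map (Pair 0) [0..<Suc ?n]) =
        map (Pair 0 \<circ> Suc) (filter (\<lambda>b. ?P (l # w) (0, Suc b)) [0..<?n])"
      unfolding upt by (simp add: filter_map o_def)
    also have "filter (\<lambda>b. ?P (l # w) (0, Suc b)) [0..<?n] =
        (if fst l \<in> fst ` set w then [first_position (fst l) w] else [])"
    proof (cases "fst l \<in> fst ` set w")
      case True
      have "first_position (fst l) w < ?n"
        using first_position_iff[OF True] by blast
      moreover have "?P (l # w) (0, Suc b) \<longleftrightarrow> b = first_position (fst l) w" if "b < ?n" for b
        using *[OF that] first_position_iff[OF True, of b] by blast
      ultimately show ?thesis
        using True filter_upt_singleton[of ?n "\<lambda>b. ?P (l # w) (0, Suc b)"] by simp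
    next
      case False
      have "\<not> ?P (l # w) (0, Suc b)" if "b < ?n" for b
        using *[OF that] False nth_mem by force
      then show ?thesis using False by (simp add: filter_empty_conv)
    qed
    finally show ?thesis by simp
  qed
  have rest: "filter (?P (l # w)) (List.product (map Suc xs) [0..<Suc ?n]) =
      map (map_prod Suc Suc) (filter (?P w) (List.product xs [0..<?n]))" for xs
  proof (induction xs)
    case (Cons a xs)
    have "filter (?P (l # w)) (map (Pair (Suc a)) [0..<Suc ?n]) =
        filter (?P (l # w)) (map (map_prod Suc Suc) (map (Pair a) [0..<?n]))"
      unfolding upt by (simp add: o_def)
    also have "\<dots> = map (map_prod Suc Suc) (filter (?P w) (map (Pair a) [0..<?n]))"
      unfolding filter_map[of _ "map_prod Suc Suc"] o_def shift by (rule refl)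
    finally show ?case using Cons by (simp del: upt_Suc)
  qed simp
  have "braid_loops (l # w) = filter (?P (l # w)) (List.product [0..<Suc ?n] [0..<Suc ?n])"
    unfolding braid_loops_def by simp
  also have "List.product [0..<Suc ?n] [0..<Suc ?n] =
      map (Pair 0) [0..<Suc ?n] @ List.product (map Suc [0..<?n]) [0..<Suc ?n]"
    by (subst (1) upt) (simp del: upt_Suc)
  finally show ?thesis
    unfolding filter_append first rest braid_loops_def by (simp only:)
qed

text \<open>In an alternating word the generator determines the sign of a letter, so generators
  suffice as arguments. A loop of column 1 pairs with itself to
  \<open>2 * t - (1 + t) = t - 1\<close>, one of column 2 to \<open>2 - (1 + t) = 1 - t\<close>, as
  the self-linkings -1 and 1 require.\<close>

definition diag_coeff :: "real \<Rightarrow> nat \<Rightarrow> real" where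
  "diag_coeff t i = (if i = 1 then t else 1)"

definition lower_coeff :: "real \<Rightarrow> nat \<Rightarrow> nat \<Rightarrow> real" where
  "lower_coeff t i j = (if i = j then 1 + t else if i = 1 then - t else - 1)"

text \<open>
  A loop \<open>(a, b)\<close> stands for \<open>e\<^sub>a - e\<^sub>b\<close>, so the form may be changed by functions of one argument
  on each pair of columns; this freedom is used to make it lower triangular.
\<close>

definition band_form :: "real \<Rightarrow> braid_word \<Rightarrow> nat \<Rightarrow> nat \<Rightarrow> real" where
  "band_form t w i j =
     (if i = j then diag_coeff t (fst (w ! i))
      else if j < i then lower_coeff t (fst (w ! i)) (fst (w ! j)) else 0)"

definition loop_form :: "real \<Rightarrow> braid_word \<Rightarrow> nat \<times> nat \<Rightarrow> nat \<times> nat \<Rightarrow> real" where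
  "loop_form t w x z =
     band_form t w (fst x) (fst z) - band_form t w (fst x) (snd z) -
     (band_form t w (snd x) (fst z) - band_form t w (snd x) (snd z))"

lemma set_braid_loops:
  "(a, b) \<in> set (braid_loops w) \<longleftrightarrow> a < b \<and> b < length w \<and> fst (w ! a) = fst (w ! b) \<and>
     (\<forall>c. a < c \<and> c < b \<longrightarrow> fst (w ! c) \<noteq> fst (w ! a))"
  by (auto simp: braid_loops_def)

lemma distinct_braid_loops: "distinct (braid_loops w)"
  by (simp add: braid_loops_def distinct_product)

text \<open>If two loops of one column overlapped without coinciding, an end of one would lie
  strictly inside the other, against consecutiveness.\<close>

lemma braid_loops_trichotomy:
  assumes "(a, b) \<in> set (braid_loops w)" "(c, d) \<in> set (braid_loops w)" "fst (w ! a) = fst (w ! c)"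
  shows "a = c \<and> b = d \<or> b \<le> c \<or> d \<le> a"
  using assms unfolding set_braid_loops by (metis linorder_neqE_nat not_less)

text \<open>Identifies the entries of \<open>V - t V^T\<close> with second differences of
  \<open>band_form\<close>. Once the order of the four end points is fixed, both sides are
  explicit.\<close>

lemma loop_form_eq:
  assumes w: "alternating_letters w"
    and x: "x \<in> set (braid_loops w)" and z: "z \<in> set (braid_loops w)"
  shows "real_of_int (loop_linking w x z) - t * real_of_int (loop_linking w z x) = loop_form t w x z"
proof -
  obtain a b c d where xz: "x = (a, b)" "z = (c, d)" by (cases x, cases z)
  have ab: "a < b" "b < length w" "fst (w ! a) = fst (w ! b)"
    and cd: "c < d" "d < length w" "fst (w ! c) = fst (w ! d)"
    using x z unfolding xz set_braid_loops by auto
  have letter: "w ! i = (1, 1) \<or> w ! i = (2, - 1)" if "i < length w" for i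
    using w nth_mem[OF that] unfolding alternating_letters_def by auto
  have len: "a < length w" "c < length w" using ab cd by auto
  show ?thesis
  proof (cases "fst (w ! a) = fst (w ! c)")
    case True
    consider "a = c" "b = d" | "b = c" | "b < c" | "d = a" | "d < a"
      using braid_loops_trichotomy[of a b w c d] x z True unfolding xz by force
    then show ?thesis
      using letter[OF len(1)] letter[OF len(2)] letter[OF ab(2)] letter[OF cd(2)] True ab cd
      by cases (auto simp: xz loop_linking_def loop_form_def band_form_def
          diag_coeff_def lower_coeff_def Let_def)
  next
    case False
    then have ne: "a \<noteq> c" "a \<noteq> d" "b \<noteq> c" "b \<noteq> d" using ab cd by auto
    \<comment> \<open>Loops of different columns share no end point, which leaves the six
      interleavings of two ordered pairs.\<close>
    consider "a < c" "b < c" | "a < c" "c < b" "b < d" | "a < c" "d < b"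
      | "c < a" "d < a" | "c < a" "a < d" "d < b" | "c < a" "b < d"
      using ne by linarith
    then show ?thesis
      using letter[OF len(1)] letter[OF len(2)] letter[OF ab(2)] letter[OF cd(2)] False ab cd ne
      by cases (auto simp: xz loop_linking_def loop_form_def band_form_def
          diag_coeff_def lower_coeff_def Let_def)
  qed
qed

section \<open>Determinants along a braid word\<close>

definition list_mat :: "'b list \<Rightarrow> ('b \<Rightarrow> 'b \<Rightarrow> 'a) \<Rightarrow> 'a mat" where
  "list_mat L h = mat (length L) (length L) (\<lambda>(r, s). h (L ! r) (L ! s))"

lemma list_mat_carrier [simp]: "list_mat L h \<in> carrier_mat (length L) (length L)"
  by (simp add: list_mat_def)

lemma list_mat_map: "list_mat (map f L) h = list_mat L (\<lambda>x y. h (f x) (f y))"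
  by (auto simp: list_mat_def intro!: eq_matI)

lemma list_mat_cong:
  assumes "\<And>x y. x \<in> set L \<Longrightarrow> y \<in> set L \<Longrightarrow> h x y = g x y"
  shows "list_mat L h = list_mat L g"
  using assms by (auto simp: list_mat_def intro!: eq_matI)

text \<open>A single column operation: the column of \<open>z0\<close> is replaced by the
  combination of all columns with weights \<open>y\<close>. The matrix \<open>C\<close> performing
  it is unitriangular, and the new first column vanishes below its top entry.\<close>

lemma det_list_mat_Cons:
  fixes h :: "'b \<Rightarrow> 'b \<Rightarrow> 'a :: idom"
  assumes 0: "\<And>x. x \<in> set L \<Longrightarrow> (\<Sum>z\<leftarrow>z0 # L. h x z * y z) = 0" and 1: "y z0 = 1"
  shows "det (list_mat (z0 # L) h) = (\<Sum>z\<leftarrow>z0 # L. h z0 z * y z) * det (list_mat L h)"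
proof -
  define n where "n = length L"
  define M where "M = z0 # L"
  have lenM: "length M = Suc n" by (simp add: M_def n_def)
  define C :: "'a mat" where
    "C = mat (Suc n) (Suc n) (\<lambda>(i, j). if j = 0 then y (M ! i) else if i = j then 1 else 0)"
  have C: "C \<in> carrier_mat (Suc n) (Suc n)" by (simp add: C_def)
  have G: "list_mat M h \<in> carrier_mat (Suc n) (Suc n)"
    using list_mat_carrier[of M h] lenM by simp
  have "det C = prod_list (diag_mat C)"
    by (rule det_lower_triangular[OF _ C]) (auto simp: C_def)
  also have "diag_mat C = map (\<lambda>_. 1) [0..<Suc n]"
    unfolding diag_mat_def by (rule map_cong) (auto simp: C_def M_def 1)
  finally have detC: "det C = 1" by (simp add: map_replicate_const del: upt_Suc)
  let ?u = "\<Sum>z\<leftarrow>M. h z0 z * y z"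
  let ?R = "mat 1 n (\<lambda>(i, j). h z0 (L ! j))"
  have sum: "(\<Sum>k<Suc n. h x (M ! k) * y (M ! k)) = (\<Sum>z\<leftarrow>M. h x z * y z)" for x
    using lenM by (simp add: sum_list_sum_nth atLeast0LessThan del: sum.lessThan_Suc)
  have "list_mat M h * C = four_block_mat (mat 1 1 (\<lambda>_. ?u)) ?R (0\<^sub>m n 1) (list_mat L h)"
    (is "_ = ?B")
  proof (rule eq_matI)
    fix i j assume "i < dim_row ?B" "j < dim_col ?B"
    then have i: "i < Suc n" and j: "j < Suc n" by (auto simp: list_mat_def n_def)
    have "(list_mat M h * C) $$ (i, j) = (\<Sum>k<Suc n. h (M ! i) (M ! k) * C $$ (k, j))"
      using i j C lenM
      by (simp add: list_mat_def scalar_prod_def atLeast0LessThan del: sum.lessThan_Suc)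
    also have "\<dots> = ?B $$ (i, j)"
    proof (cases j)
      case 0
      have "(\<Sum>k<Suc n. h (M ! i) (M ! k) * C $$ (k, j)) = (\<Sum>z\<leftarrow>M. h (M ! i) z * y z)"
        unfolding sum[symmetric] using 0 by (intro sum.cong) (auto simp: C_def)
      also have "\<dots> = ?B $$ (i, j)"
        using 0 i assms(1)[of "L ! (i - 1)"]
        by (cases i) (auto simp: M_def n_def list_mat_def)
      finally show ?thesis .
    next
      case (Suc j')
      have "(\<Sum>k<Suc n. h (M ! i) (M ! k) * C $$ (k, j)) =
          (\<Sum>k<Suc n. if k = j then h (M ! i) (M ! k) else 0)"
        using Suc j by (intro sum.cong) (auto simp: C_def)
      also have "\<dots> = h (M ! i) (M ! j)" using j by (simp del: sum.lessThan_Suc)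
      also have "\<dots> = ?B $$ (i, j)"
        using Suc i j by (cases i) (auto simp: M_def n_def list_mat_def)
      finally show ?thesis .
    qed
    finally show "(list_mat M h * C) $$ (i, j) = ?B $$ (i, j)" .
  qed (use C lenM in \<open>auto simp: list_mat_def n_def\<close>)
  then have "det (list_mat M h * C) = det (mat 1 1 (\<lambda>_. ?u)) * det (list_mat L h)"
    using list_mat_carrier[of L h, folded n_def]
    by (simp add: det_four_block_mat_lower_left_zero[of _ 1 _ n])
  also have "det (mat 1 1 (\<lambda>_. ?u)) = ?u" by (simp add: det_single)
  finally show ?thesis using det_mult[OF G C] detC by (simp add: M_def)
qed

text \<open>Evaluation at \<open>t\<close> is a ring homomorphism and commutes with the
  determinant.\<close>

lemma poly_Alexander_polynomial:
  "poly (map_poly real_of_int (Alexander_polynomial w)) t =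
     det (list_mat (braid_loops w)
       (\<lambda>x z. real_of_int (loop_linking w x z) - t * real_of_int (loop_linking w z x)))"
proof -
  let ?f = "\<lambda>p. poly (map_poly real_of_int p) t"
  interpret comm_ring_hom ?f
    by unfold_locales (simp_all add: of_int_poly_hom.hom_add of_int_poly_hom.hom_mult)
  show ?thesis
    unfolding Alexander_polynomial_def Let_def hom_det[symmetric]
    by (intro arg_cong[where f = det] eq_matI)
      (auto simp: list_mat_def Seifert_matrix_def Let_def hom_minus hom_mult
          of_int_hom.map_poly_pCons_hom)
qed

lemma det_loop_form_eq_poly:
  assumes "alternating_letters w"
  shows "det (list_mat (braid_loops w) (loop_form t w)) =
    poly (map_poly real_of_int (Alexander_polynomial w)) t"
  unfolding poly_Alexander_polynomial
  by (intro arg_cong[where f = det] list_mat_cong) (simp add: loop_form_eq[OF assms])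

section \<open>Eliminating the loop opened by a new first letter\<close>

lemma band_form_Suc: "band_form t (l # w) (Suc i) (Suc j) = band_form t w i j"
  by (simp add: band_form_def)

lemma loop_form_Cons:
  "loop_form t (l # w) (map_prod Suc Suc x) (map_prod Suc Suc z) = loop_form t w x z"
  by (simp add: loop_form_def band_form_Suc)

lemma list_mat_braid_loops_Cons:
  "list_mat (map (map_prod Suc Suc) (braid_loops w)) (loop_form t (l # w)) =
     list_mat (braid_loops w) (loop_form t w)"
  by (simp add: list_mat_map loop_form_Cons)

definition lower_dot :: "real \<Rightarrow> nat \<Rightarrow> (nat \<Rightarrow> real) \<Rightarrow> real" where
  "lower_dot t i r = lower_coeff t i 1 * r 1 + lower_coeff t i 2 * r 2"

text \<open>Forward substitution in the triangular form. The state \<open>r\<close> holds, up to a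
  shift, the sum of the weights given so far to the bands of each column;
  \<open>lower_dot t i r\<close> is their contribution to the row of a band of column
  \<open>i\<close>, and the band at the current letter gets the weight that cancels it.\<close>

definition burau_step :: "real \<Rightarrow> nat \<Rightarrow> (nat \<Rightarrow> real) \<Rightarrow> nat \<Rightarrow> real" where
  "burau_step t i r = r(i := r i - lower_dot t i r / diag_coeff t i)"

definition burau_run :: "real \<Rightarrow> braid_word \<Rightarrow> (nat \<Rightarrow> real) \<Rightarrow> nat \<Rightarrow> real" where
  "burau_run t w r = fold (\<lambda>l. burau_step t (fst l)) w r"

text \<open>The weight that the run gives to band \<open>j\<close>.\<close>

definition band_increment :: "real \<Rightarrow> braid_word \<Rightarrow> (nat \<Rightarrow> real) \<Rightarrow> nat \<Rightarrow> real" where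
  "band_increment t w r j =
     burau_run t (take (Suc j) w) r (fst (w ! j)) - burau_run t (take j w) r (fst (w ! j))"

text \<open>A combination of bands whose weights add up to 0 in each column is a combination of
  loops; the weight of a loop is the partial sum up to its first band. Adding \<open>y\<close>
  undoes the shift of the initial state.\<close>

definition loop_coeff :: "real \<Rightarrow> braid_word \<Rightarrow> (nat \<Rightarrow> real) \<Rightarrow> (nat \<Rightarrow> real) \<Rightarrow> nat \<Rightarrow> real" where
  "loop_coeff t w r y c = burau_run t (take (Suc c) w) r (fst (w ! c)) + y (fst (w ! c))"

lemma burau_run_Cons: "burau_run t (l # w) r = burau_run t w (burau_step t (fst l) r)"
  by (simp add: burau_run_def)

lemma burau_run_Nil [simp]: "burau_run t [] r = r"
  by (simp add: burau_run_def)

lemma band_increment_Suc: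
  "band_increment t (l # w) r (Suc j) = band_increment t w (burau_step t (fst l) r) j"
  by (simp add: band_increment_def burau_run_Cons)

lemma band_increment_0:
  "band_increment t (l # w) r 0 = - (lower_dot t (fst l) r / diag_coeff t (fst l))"
  by (simp add: band_increment_def burau_run_Cons burau_step_def)

lemma loop_coeff_Suc:
  "loop_coeff t (l # w) r y (Suc c) = loop_coeff t w (burau_step t (fst l) r) y c"
  by (simp add: loop_coeff_def burau_run_Cons)

lemma loop_coeff_0:
  "loop_coeff t (l # w) r y 0 = burau_step t (fst l) r (fst l) + y (fst l)"
  by (simp add: loop_coeff_def burau_run_Cons)

lemma burau_run_outside:
  "i \<notin> fst ` set w \<Longrightarrow> burau_run t w r i = r i"
  by (induction w arbitrary: r) (auto simp: burau_run_Cons burau_step_def)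

text \<open>Summation by parts over the loops of each column.\<close>

lemma sum_braid_loops:
  assumes "alternating_letters w" and "\<And>i. i \<in> {1, 2} \<Longrightarrow> burau_run t w r i = - y i"
  shows "(\<Sum>z\<leftarrow>braid_loops w. loop_coeff t w r y (fst z) * (g (fst z) - g (snd z))) =
    (\<Sum>j<length w. band_increment t w r j * g j) +
    (r 1 + y 1) * g (first_position 1 w) + (r 2 + y 2) * g (first_position 2 w)"
  using assms
proof (induction w arbitrary: r g)
  case (Cons l w)
  let ?i = "fst l" and ?r = "burau_step t (fst l) r"
  let ?s = "\<lambda>j. (?r j + y j) * g (Suc (first_position j w))"
  have w: "alternating_letters w" and i: "?i = 1 \<or> ?i = 2"
    using Cons.prems(1) by (auto simp: alternating_letters_def)
  have IH: "(\<Sum>z\<leftarrow>braid_loops w. loop_coeff t w ?r y (fst z) *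
        (g (Suc (fst z)) - g (Suc (snd z)))) =
      (\<Sum>j<length w. band_increment t w ?r j * g (Suc j)) + ?s 1 + ?s 2"
    using Cons.IH[of ?r "\<lambda>j. g (Suc j)"] w Cons.prems(2) by (simp add: burau_run_Cons)
  \<comment> \<open>A letter that does not recur opens no loop. Its column is already in the final
    state, so the boundary term is zero.\<close>
  have out: "?r ?i + y ?i = 0" if "?i \<notin> fst ` set w"
    using burau_run_outside[OF that, of t ?r] Cons.prems(2)[of ?i] i
    by (auto simp: burau_run_Cons)
  have "(\<Sum>z\<leftarrow>braid_loops (l # w). loop_coeff t (l # w) r y (fst z) * (g (fst z) - g (snd z))) =
      (?r ?i + y ?i) * (g 0 - g (Suc (first_position ?i w))) +
      (\<Sum>z\<leftarrow>braid_loops w. loop_coeff t w ?r y (fst z) * (g (Suc (fst z)) - g (Suc (snd z))))"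
    using out by (auto simp: braid_loops_Cons loop_coeff_0 loop_coeff_Suc o_def)
  also have "\<dots> = (\<Sum>j<length (l # w). band_increment t (l # w) r j * g j) +
      (r 1 + y 1) * g (first_position 1 (l # w)) + (r 2 + y 2) * g (first_position 2 (l # w))"
    unfolding IH using i
    by (auto simp: first_position_Cons band_increment_0 band_increment_Suc
        sum.lessThan_Suc_shift burau_step_def algebra_simps diff_divide_distrib
        simp del: sum.lessThan_Suc)
  finally show ?case .
qed simp

lemma diag_coeff_nonzero: "t \<noteq> 0 \<Longrightarrow> diag_coeff t i \<noteq> 0"
  by (simp add: diag_coeff_def)

text \<open>The weight of band \<open>a\<close> cancels what the state before it contributes; only
  the initial state remains, and the row matters through its column alone.\<close>

lemma sum_band_form:
  assumes "alternating_letters w" "t \<noteq> 0" "a < length w"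
  shows "(\<Sum>j<length w. band_increment t w r j * band_form t w a j) =
    - lower_dot t (fst (w ! a)) r"
  using assms
proof (induction w arbitrary: r a)
  case (Cons l w)
  let ?r = "burau_step t (fst l) r"
  have w: "alternating_letters w" and i: "fst l = 1 \<or> fst l = 2"
    using Cons.prems(1) by (auto simp: alternating_letters_def)
  show ?case
  proof (cases a)
    case 0
    then show ?thesis
      using diag_coeff_nonzero[OF Cons.prems(2)]
      by (simp add: sum.lessThan_Suc_shift band_increment_0 band_form_def
          del: sum.lessThan_Suc)
  next
    case (Suc a')
    have "(\<Sum>j<length w. band_increment t w ?r j * band_form t w a' j) =
        - lower_dot t (fst (w ! a')) ?r"
      using Cons.IH[of a' ?r] w Cons.prems Suc by simp
    moreover have "lower_dot t (fst (w ! a')) ?r = lower_dot t (fst (w ! a')) r -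
        lower_coeff t (fst (w ! a')) (fst l) * (lower_dot t (fst l) r / diag_coeff t (fst l))"
      using i by (auto simp: burau_step_def lower_dot_def[of t "fst (w ! a')"] algebra_simps)
    moreover have "band_form t (l # w) (Suc a') 0 = lower_coeff t (fst (w ! a')) (fst l)"
      by (simp add: band_form_def)
    ultimately show ?thesis
      using Suc
      by (simp add: sum.lessThan_Suc_shift band_increment_0 band_increment_Suc band_form_Suc
          del: sum.lessThan_Suc)
  qed
qed simp

text \<open>The run starts from \<open>e_i - y\<close>: the new band has weight 1, and ending at
  \<open>- y\<close> means that the weights add up to 0 in each column. The resulting combination of
  columns pairs with each later band to a value depending on its column only, which cancels in the
  difference that a later loop stands for.\<close>

lemma det_loop_form_Cons:
  fixes y :: "nat \<Rightarrow> real"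
  defines "u \<equiv> \<lambda>i r. (if r = i then 1 else 0) - y r"
  assumes w: "alternating_letters (l # w)" and t: "t \<noteq> 0" and l: "fst l \<in> fst ` set w"
    and y: "\<And>i. i \<in> {1, 2} \<Longrightarrow> burau_run t w (u (fst l)) i = - y i"
  shows "det (list_mat (braid_loops (l # w)) (loop_form t (l # w))) =
    (diag_coeff t (fst l) - lower_dot t (fst l) y) *
      det (list_mat (braid_loops w) (loop_form t w))"
proof -
  let ?i = "fst l" and ?r = "u (fst l)"
  have w': "alternating_letters w" and i: "?i = 1 \<or> ?i = 2"
    using w by (auto simp: alternating_letters_def)
  let ?z0 = "(0, Suc (first_position ?i w))"
  let ?L = "map (map_prod Suc Suc) (braid_loops w)"
  define c :: "nat \<times> nat \<Rightarrow> real" where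
    "c z = (case fst z of 0 \<Rightarrow> 1 | Suc j \<Rightarrow> loop_coeff t w ?r y j)"
    for z
  have loops: "braid_loops (l # w) = ?z0 # ?L" using l by (simp add: braid_loops_Cons)
  have col: "(\<Sum>z\<leftarrow>?z0 # ?L. (g (fst z) - g (snd z)) * c z) =
      g 0 + (\<Sum>j<length w. band_increment t w ?r j * g (Suc j))" for g
    using sum_braid_loops[OF w' y, of "\<lambda>j. g (Suc j)"] i
    by (auto simp: c_def o_def u_def mult.commute)
  \<comment> \<open>The pairing of band \<open>a\<close> with the chosen combination of
    bands.\<close>
  define B where "B = (\<lambda>a. band_form t (l # w) a 0 +
      (\<Sum>j<length w. band_increment t w ?r j * band_form t (l # w) a (Suc j)))"
  have B0: "B 0 = diag_coeff t ?i" by (simp add: B_def band_form_def)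
  have BSuc: "B (Suc a) = lower_dot t (fst (w ! a)) y" if "a < length w" for a
  proof -
    have "(\<Sum>j<length w. band_increment t w ?r j * band_form t (l # w) (Suc a) (Suc j)) =
        - lower_dot t (fst (w ! a)) ?r"
      using sum_band_form[OF w' t that, of ?r] by (simp add: band_form_Suc)
    moreover have "lower_dot t j ?r = lower_coeff t j ?i - lower_dot t j y" for j
      using i by (auto simp: lower_dot_def u_def algebra_simps)
    ultimately show ?thesis by (simp add: B_def band_form_def)
  qed
  have row: "(\<Sum>z\<leftarrow>?z0 # ?L. loop_form t (l # w) x z * c z) = B (fst x) - B (snd x)" for x
    using col[of "\<lambda>j. band_form t (l # w) (fst x) j - band_form t (l # w) (snd x) j"]
    unfolding loop_form_def B_def by (simp add: algebra_simps sum_subtractf)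
  have "det (list_mat (?z0 # ?L) (loop_form t (l # w))) =
      (\<Sum>z\<leftarrow>?z0 # ?L. loop_form t (l # w) ?z0 z * c z) * det (list_mat ?L (loop_form t (l # w)))"
  proof (rule det_list_mat_Cons)
    fix x assume "x \<in> set ?L"
    then obtain a b where "(a, b) \<in> set (braid_loops w)" "x = (Suc a, Suc b)" by auto
    then show "(\<Sum>z\<leftarrow>?z0 # ?L. loop_form t (l # w) x z * c z) = 0"
      unfolding row by (auto simp: BSuc set_braid_loops)
  qed (simp add: c_def)
  moreover have "first_position ?i w < length w" "fst (w ! first_position ?i w) = ?i"
    using first_position_iff[OF l] by blast+
  ultimately show ?thesis
    unfolding loops row list_mat_braid_loops_Cons by (simp add: B0 BSuc)
qed

section \<open>The Burau representation\<close>

text \<open>The matrices \<open>(1, s; 0, s)\<close> and \<open>(1, 0; 1, s)\<close>; every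
  \<open>i\<close> other than 1 selects the second. The coefficient ring is left general because
  \<open>s\<close> is later both a real number and the indeterminate.\<close>

definition burau_mult :: "'a :: comm_ring_1 \<Rightarrow> nat \<Rightarrow> 'a \<times> 'a \<Rightarrow> 'a \<times> 'a" where
  "burau_mult s i v = (if i = 1 then (fst v + s * snd v, s * snd v) else (fst v, fst v + s * snd v))"

definition burau_prod :: "'a :: comm_ring_1 \<Rightarrow> nat list \<Rightarrow> 'a \<times> 'a \<Rightarrow> 'a \<times> 'a" where
  "burau_prod s is v = foldr (burau_mult s) is v"

definition burau_trace :: "'a :: comm_ring_1 \<Rightarrow> nat list \<Rightarrow> 'a" where
  "burau_trace s is = fst (burau_prod s is (1, 0)) + snd (burau_prod s is (0, 1))"

lemma burau_prod_Nil [simp]: "burau_prod s [] v = v"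
  by (simp add: burau_prod_def)

lemma burau_prod_Cons [simp]: "burau_prod s (i # is) v = burau_mult s i (burau_prod s is v)"
  by (simp add: burau_prod_def)

lemma burau_prod_append: "burau_prod s (is @ js) v = burau_prod s is (burau_prod s js v)"
  by (simp add: burau_prod_def)

lemma burau_prod_linear:
  "burau_prod s is (x, y) =
    (x * fst (burau_prod s is (1, 0)) + y * fst (burau_prod s is (0, 1)),
     x * snd (burau_prod s is (1, 0)) + y * snd (burau_prod s is (0, 1)))"
  by (induction "is") (auto simp: burau_mult_def algebra_simps)

lemma burau_prod_det:
  "fst (burau_prod s is (1, 0)) * snd (burau_prod s is (0, 1)) -
   fst (burau_prod s is (0, 1)) * snd (burau_prod s is (1, 0)) = s ^ length is"
proof (induction "is")
  case (Cons i "is")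
  then show ?case
    by (auto simp: burau_mult_def algebra_simps simp flip: Cons.IH)
qed simp

lemma burau_prod_bounds:
  fixes s :: real
  assumes "s > 0" "x \<ge> 0" "y \<ge> 0"
  shows "fst (burau_prod s is (x, y)) \<ge> x \<and> snd (burau_prod s is (x, y)) \<ge> s ^ length is * y"
proof (induction "is")
  case (Cons i "is")
  let ?v = "burau_prod s is (x, y)"
  have "snd ?v \<ge> 0" using Cons assms by (meson mult_nonneg_nonneg order.trans zero_le_power less_imp_le)
  then have "s * snd ?v \<ge> 0" "fst ?v \<ge> 0" using Cons assms by auto
  moreover have "s * (s ^ length is * y) \<le> s * snd ?v"
    using Cons assms by (intro mult_left_mono) auto
  ultimately show ?case
    using Cons unfolding burau_mult_def length_Cons power_Suc mult.assoc burau_prod_Cons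
    by (auto simp del: mult_le_cancel_left_pos)
qed simp

text \<open>The diagonal entries of the product are at least 1 and \<open>s ^ length is\<close>, and
  \<open>1 + x * y > x + y\<close> for \<open>x, y < 1\<close>. This keeps the denominator in
  \<open>burau_fixed_vector\<close> away from zero.\<close>

lemma burau_trace_gt:
  fixes s :: real
  assumes s: "0 < s" "s < 1" and "is": "set is = {1, 2}"
  shows "burau_trace s is > s ^ count_list is 1 + s ^ count_list is 2"
proof -
  have pos: "count_list is i > 0" if "i \<in> set is" for i
    using that by (simp add: count_list_0_iff zero_less_iff_neq_zero)
  have lt: "s ^ count_list is 1 < 1" "s ^ count_list is 2 < 1"
    using s pos "is" by (auto intro: power_less_one_iff[THEN iffD2])
  have "length is = count_list is 1 + count_list is 2"
    using sum_count_set[of "is" "{1, 2}"] "is" by simp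
  then have "burau_trace s is \<ge> 1 + s ^ count_list is 1 * s ^ count_list is 2"
    using burau_prod_bounds[of s 1 0 "is"] burau_prod_bounds[of s 0 1 "is"] s
    by (simp add: burau_trace_def power_add)
  moreover have "(1 - s ^ count_list is 1) * (1 - s ^ count_list is 2) > 0"
    using lt by simp
  ultimately show ?thesis by (simp add: algebra_simps)
qed

text \<open>A run applies the first letter first, \<open>foldr\<close> the last one, hence
  \<open>rev\<close>. Each letter of generator 1 brings a factor \<open>1 / s\<close>, from the
  division by \<open>diag_coeff (- s) 1 = - s\<close>.\<close>

lemma burau_run_eq_prod:
  assumes "alternating_letters w" "s \<noteq> 0"
  shows "burau_run (- s) w r 1 =
      fst (burau_prod s (rev (map fst w)) (r 1, r 2)) / s ^ count_list (map fst w) 1 \<and>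
    burau_run (- s) w r 2 =
      snd (burau_prod s (rev (map fst w)) (r 1, r 2)) / s ^ count_list (map fst w) 1"
  using assms
proof (induction w arbitrary: r)
  case (Cons l w)
  have w: "alternating_letters w" and l: "fst l = 1 \<or> fst l = 2"
    using Cons.prems(1) by (auto simp: alternating_letters_def)
  have scale: "fst (burau_prod s is (x / s, y / s)) = fst (burau_prod s is (x, y)) / s"
      "snd (burau_prod s is (x / s, y / s)) = snd (burau_prod s is (x, y)) / s" for "is" x y
    by (subst (1 2) burau_prod_linear, simp add: add_divide_distrib)+
  show ?case
  proof (cases "fst l = 1")
    case True
    define x z where "x = r 1 + s * r 2" and "z = s * r 2"
    have "burau_step (- s) 1 r 1 = x / s" "burau_step (- s) 1 r 2 = z / s"
      using Cons.prems(2) by (auto simp: x_def z_def burau_step_def lower_dot_def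
          lower_coeff_def diag_coeff_def field_simps)
    moreover have "burau_mult s 1 (r 1, r 2) = (x, z)" by (simp add: burau_mult_def x_def z_def)
    ultimately show ?thesis
      using Cons.IH[OF w Cons.prems(2), of "burau_step (- s) 1 r"] True
      by (simp add: burau_run_Cons burau_prod_append scale)
  next
    case False
    then have "fst l = 2" using l by simp
    moreover have "burau_step (- s) 2 r 1 = r 1" "burau_step (- s) 2 r 2 = r 1 + s * r 2"
      by (auto simp: burau_step_def lower_dot_def lower_coeff_def diag_coeff_def algebra_simps)
    ultimately show ?thesis
      using Cons.IH[OF w Cons.prems(2), of "burau_step (- s) 2 r"]
      by (simp add: burau_run_Cons burau_prod_append burau_mult_def)
  qed
qed simp

section \<open>The closed formula for the determinant\<close>

lemma burau_prod_replicate_2: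
  "(1 - s) * fst (burau_prod s (replicate q 2) (x, y)) = (1 - s) * x \<and>
   (1 - s) * snd (burau_prod s (replicate q 2) (x, y)) = (1 - s ^ q) * x + (1 - s) * s ^ q * y"
proof (induction q)
  case (Suc q)
  let ?v = "burau_prod s (replicate q 2) (x, y)"
  have "(1 - s) * (fst ?v + s * snd ?v) = (1 - s) * fst ?v + s * ((1 - s) * snd ?v)"
    by (simp add: algebra_simps)
  also have "\<dots> = (1 - s ^ Suc q) * x + (1 - s) * s ^ Suc q * y"
    unfolding Suc.IH[THEN conjunct1] Suc.IH[THEN conjunct2] by (simp add: algebra_simps)
  finally show ?case using Suc.IH by (simp add: burau_mult_def)
qed simp

text \<open>The classical quotient of \<open>det (1 - M)\<close> by \<open>1 + t + t^2\<close> at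
  \<open>t = - s\<close>, multiplied by \<open>- s ^ P\<close>. Here \<open>P\<close> and
  \<open>Q\<close> are the two counts and \<open>M\<close> is the product divided by
  \<open>s ^ P\<close>, so that \<open>det M = s ^ Q / s ^ P\<close>.\<close>

definition alexander_value :: "real \<Rightarrow> nat list \<Rightarrow> real" where
  "alexander_value s is =
    (burau_trace s is - s ^ count_list is 1 - s ^ count_list is 2) / (1 - s + s\<^sup>2)"

lemma cyclotomic_pos: "1 - s + s\<^sup>2 > (0 :: real)"
proof -
  have "1 - s + s\<^sup>2 = (s - 1 / 2)\<^sup>2 + 3 / 4" by (simp add: power2_eq_square algebra_simps)
  also have "\<dots> > 0" by (simp add: add_nonneg_pos)
  finally show ?thesis .
qed

text \<open>The start of the induction. With generator 2 alone the trace is \<open>1 + s ^ q\<close>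
  for \<open>q\<close> letters, and the denominator of \<open>burau_fixed_vector\<close> would be
  zero; a vector \<open>y\<close> supported in column 2 serves instead.\<close>

lemma det_loop_form_replicate:
  assumes s: "0 < s" "s < 1"
  shows "det (list_mat (braid_loops (replicate (Suc q) (2, - 1)))
      (loop_form (- s) (replicate (Suc q) (2, - 1)))) = (1 - s ^ Suc q) / (1 - s)"
proof (induction q)
  case 0
  then show ?case
    using s det_dim_zero[OF list_mat_carrier[of "[]", simplified]] by (simp add: braid_loops_Cons)
next
  case (Suc q)
  let ?w = "replicate (Suc q) (2 :: nat, - 1 :: int)"
  \<comment> \<open>The entry in column 2 solves
    \<open>s ^ Suc q * (1 - y 2) = - y 2\<close>.\<close>
  define y :: "nat \<Rightarrow> real" where
    "y = (\<lambda>i. if i = 2 then - (s ^ Suc q) / (1 - s ^ Suc q) else 0)"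
  have ne: "1 - s ^ Suc q \<noteq> 0" using s power_less_one_iff[of s "Suc q"] by simp
  have w: "alternating_letters ((2, - 1) # ?w)" by (auto simp: alternating_letters_def)
  have w': "alternating_letters ?w" by (auto simp: alternating_letters_def)
  let ?u = "\<lambda>r. (if r = 2 then 1 else 0) - y r"
  have prod: "fst (burau_prod s (replicate (Suc q) 2) (?u 1, ?u 2)) = 0"
     "snd (burau_prod s (replicate (Suc q) 2) (?u 1, ?u 2)) = s ^ Suc q * ?u 2"
    using burau_prod_replicate_2[of s "Suc q" "?u 1" "?u 2"] s
    by (auto simp: y_def simp del: replicate_Suc power_Suc)
  have cnt: "count_list (replicate (Suc q) (2 :: nat)) 1 = 0"
    by (auto simp: count_list_0_iff simp del: replicate_Suc)
  have "burau_run (- s) ?w ?u i = - y i" if "i \<in> {1, 2}" for i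
    using that burau_run_eq_prod[OF w', of s ?u] s prod cnt ne
    by (auto simp: y_def field_simps map_replicate simp del: replicate_Suc power_Suc)
  then have "det (list_mat (braid_loops ((2, - 1) # ?w)) (loop_form (- s) ((2, - 1) # ?w))) =
    (diag_coeff (- s) 2 - lower_dot (- s) 2 y) * det (list_mat (braid_loops ?w) (loop_form (- s) ?w))"
    using det_loop_form_Cons[OF w, of "- s" y] s by simp
  also have "diag_coeff (- s) 2 - lower_dot (- s) 2 y = (1 - s ^ Suc (Suc q)) / (1 - s ^ Suc q)"
    using ne by (simp add: diag_coeff_def lower_dot_def lower_coeff_def y_def field_simps)
  finally show ?case using Suc ne by (simp del: power_Suc)
qed

text \<open>With \<open>M\<close> the matrix of the run, the condition reads
  \<open>(M - 1) y = M e_i\<close> and is solved by Cramer's rule. The factor that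
  \<open>det_loop_form_Cons\<close> attaches to a new letter \<open>i\<close> is then, up to sign,
  the quotient of two consecutive values of \<open>alexander_value\<close>.\<close>

lemma burau_fixed_vector:
  assumes w: "alternating_letters w" and s: "0 < s" "s < 1" and types: "fst ` set w = {1, 2}"
    and i: "i \<in> {1, 2}"
  shows "\<exists>y. (\<forall>j\<in>{1, 2}. burau_run (- s) w (\<lambda>r. (if r = i then 1 else 0) - y r) j = - y j) \<and>
    (diag_coeff (- s) i - lower_dot (- s) i y) * alexander_value s (rev (map fst w)) =
      (if i = 1 then - 1 else 1) * alexander_value s (rev (map fst w) @ [i])"
proof -
  define I where "I = rev (map fst w)"
  define P where "P = s ^ count_list I 1"
  define Q where "Q = s ^ count_list I 2"
  have setI: "set I = {1, 2}" using types by (auto simp: I_def)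
  have P: "P > 0" using s by (simp add: P_def)
  have len: "length I = count_list I 1 + count_list I 2"
    using sum_count_set[of I "{1, 2}"] setI by simp
  define a b c d where abcd: "a = fst (burau_prod s I (1, 0))" "b = fst (burau_prod s I (0, 1))"
    "c = snd (burau_prod s I (1, 0))" "d = snd (burau_prod s I (0, 1))"
  have prod: "burau_prod s I (x, y) = (x * a + y * b, x * c + y * d)" for x y
    unfolding abcd by (rule burau_prod_linear)
  have det: "a * d - b * c = P * Q"
    using burau_prod_det[of s I] by (simp add: abcd P_def Q_def len power_add)
  have tr: "burau_trace s I = a + d" by (simp add: burau_trace_def abcd)
  \<comment> \<open>\<open>D / P\<close> is \<open>det (1 - M)\<close>.\<close>
  define D where "D = P + Q - (a + d)"
  have D: "D < 0"
    using burau_trace_gt[OF s setI] by (simp add: D_def tr P_def Q_def)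
  have run: "burau_run (- s) w r 1 = (r 1 * a + r 2 * b) / P"
       "burau_run (- s) w r 2 = (r 1 * c + r 2 * d) / P" for r
    using burau_run_eq_prod[OF w, of s r] s by (simp_all add: prod flip: I_def) (simp_all add: P_def I_def)
  have val: "alexander_value s I = - D / (1 - s + s\<^sup>2)"
    by (simp add: alexander_value_def tr D_def P_def Q_def)
  show ?thesis
  proof (cases "i = 1")
    case True
    define y :: "nat \<Rightarrow> real" where
      "y = (\<lambda>j. if j = 1 then (Q - a) / D else if j = 2 then - c / D else 0)"
    have y: "D * y 1 = Q - a" "D * y 2 = - c" using D by (auto simp: y_def)
    have "D * ((1 - y 1) * a - y 2 * b) = D * (- y 1 * P)"
    proof -
      have "D * ((1 - y 1) * a - y 2 * b) - D * (- y 1 * P) = D * a - (D * y 1) * a - (D * y 2) * b + (D * y 1) * P"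
        by (simp add: algebra_simps)
      also have "\<dots> = 0" unfolding y using det by (simp add: D_def algebra_simps)
      finally show ?thesis by simp
    qed
    moreover have "D * ((1 - y 1) * c - y 2 * d) = D * (- y 2 * P)"
    proof -
      have "D * ((1 - y 1) * c - y 2 * d) - D * (- y 2 * P) = D * c - (D * y 1) * c - (D * y 2) * d + (D * y 2) * P"
        by (simp add: algebra_simps)
      also have "\<dots> = 0" unfolding y using det by (simp add: D_def algebra_simps)
      finally show ?thesis by simp
    qed
    ultimately have "(1 - y 1) * a - y 2 * b = - y 1 * P" "(1 - y 1) * c - y 2 * d = - y 2 * P"
      using less_imp_neq[OF D] by (simp_all only: mult_cancel_left simp_thms)
    then have run': "burau_run (- s) w (\<lambda>r. (if r = i then 1 else 0) - y r) j = - y j"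
      if "j \<in> {1, 2}" for j
      using that P True by (auto simp: run[unfolded One_nat_def] field_simps)
    have "burau_trace s (I @ [1]) = a + s * (c + d)"
      by (simp add: burau_trace_def burau_prod_append burau_mult_def prod algebra_simps)
    then have val': "alexander_value s (I @ [1]) = (a + s * (c + d) - s * P - Q) / (1 - s + s\<^sup>2)"
      by (simp add: alexander_value_def P_def Q_def)
    have "(- s - ((1 - s) * y 1 + s * y 2)) * (- D) = - (a + s * (c + d) - s * P - Q)"
    proof -
      have "(- s - ((1 - s) * y 1 + s * y 2)) * (- D) = s * D + (1 - s) * (D * y 1) + s * (D * y 2)"
        by (simp add: algebra_simps)
      then show ?thesis unfolding y by (simp add: D_def algebra_simps)
    qed
    then have "(diag_coeff (- s) i - lower_dot (- s) i y) * alexander_value s I =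
        - alexander_value s (I @ [i])"
      unfolding True val val' by (simp add: diag_coeff_def lower_dot_def lower_coeff_def)
    then show ?thesis using run' True unfolding I_def by auto
  next
    case False
    then have i2: "i = 2" using i by simp
    define y :: "nat \<Rightarrow> real" where
      "y = (\<lambda>j. if j = 1 then - b / D else if j = 2 then (Q - d) / D else 0)"
    have y: "D * y 1 = - b" "D * y 2 = Q - d" using D by (auto simp: y_def)
    have "D * (- y 1 * a + (1 - y 2) * b) = D * (- y 1 * P)"
    proof -
      have "D * (- y 1 * a + (1 - y 2) * b) - D * (- y 1 * P) = D * b - (D * y 1) * a - (D * y 2) * b + (D * y 1) * P"
        by (simp add: algebra_simps)
      also have "\<dots> = 0" unfolding y using det by (simp add: D_def algebra_simps)
      finally show ?thesis by simp
    qed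
    moreover have "D * (- y 1 * c + (1 - y 2) * d) = D * (- y 2 * P)"
    proof -
      have "D * (- y 1 * c + (1 - y 2) * d) - D * (- y 2 * P) = D * d - (D * y 1) * c - (D * y 2) * d + (D * y 2) * P"
        by (simp add: algebra_simps)
      also have "\<dots> = 0" unfolding y using det by (simp add: D_def algebra_simps)
      finally show ?thesis by simp
    qed
    ultimately have "- y 1 * a + (1 - y 2) * b = - y 1 * P" "- y 1 * c + (1 - y 2) * d = - y 2 * P"
      using less_imp_neq[OF D] by (simp_all only: mult_cancel_left simp_thms)
    then have run': "burau_run (- s) w (\<lambda>r. (if r = i then 1 else 0) - y r) j = - y j"
      if "j \<in> {1, 2}" for j
      using that P i2 by (auto simp: run[unfolded One_nat_def] field_simps)
    have "burau_trace s (I @ [2]) = a + b + s * d"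
      by (simp add: burau_trace_def burau_prod_append burau_mult_def prod algebra_simps)
    then have val': "alexander_value s (I @ [2]) = (a + b + s * d - P - s * Q) / (1 - s + s\<^sup>2)"
      by (simp add: alexander_value_def P_def Q_def)
    have "(1 - (- y 1 + (1 - s) * y 2)) * (- D) = a + b + s * d - P - s * Q"
    proof -
      have "(1 - (- y 1 + (1 - s) * y 2)) * (- D) = - D - D * y 1 + (1 - s) * (D * y 2)"
        by (simp add: algebra_simps)
      then show ?thesis unfolding y by (simp add: D_def algebra_simps)
    qed
    moreover have "diag_coeff (- s) 2 - lower_dot (- s) 2 y = 1 - (- y 1 + (1 - s) * y 2)"
      by (simp add: diag_coeff_def lower_dot_def lower_coeff_def)
    ultimately have "(diag_coeff (- s) i - lower_dot (- s) i y) * alexander_value s I =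
        alexander_value s (I @ [i])"
      unfolding i2 val val' times_divide_eq_right by (simp only:)
    then show ?thesis using run' i2 unfolding I_def by auto
  qed
qed

text \<open>Letters are put in front one at a time and the quotients from
  \<open>burau_fixed_vector\<close> telescope, each letter of generator 1 adding a sign. The last
  letter keeps generator 2 present in every nonempty tail.\<close>

lemma det_loop_form:
  assumes "alternating_letters w" "w \<noteq> []" "last w = (2, - 1)" "1 \<in> fst ` set w"
    and s: "0 < s" "s < 1"
  shows "det (list_mat (braid_loops w) (loop_form (- s) w)) =
    (- 1) ^ Suc (count_list (map fst w) 1) * alexander_value s (rev (map fst w))"
  using assms(1-4)
proof (induction w)
  case (Cons l w)
  have w: "alternating_letters w" and l: "l = (1, 1) \<or> l = (2, - 1)"
    using Cons.prems(1) by (auto simp: alternating_letters_def)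
  have ne: "w \<noteq> []" and last: "last w = (2, - 1)"
    using Cons.prems by (cases "w = []"; auto)+
  show ?case
  proof (cases "1 \<in> fst ` set w")
    case True
    have "2 \<in> fst ` set w" using last_in_set[OF ne] last by (metis fst_conv imageI)
    then have types: "fst ` set w = {1, 2}"
      using True w by (auto simp: alternating_letters_def)
    obtain y where y: "\<forall>j\<in>{1, 2}.
        burau_run (- s) w (\<lambda>r. (if r = fst l then 1 else 0) - y r) j = - y j"
      "(diag_coeff (- s) (fst l) - lower_dot (- s) (fst l) y) * alexander_value s (rev (map fst w)) =
        (if fst l = 1 then - 1 else 1) * alexander_value s (rev (map fst w) @ [fst l])"
      using burau_fixed_vector[OF w s types, of "fst l"] l by force
    have "det (list_mat (braid_loops (l # w)) (loop_form (- s) (l # w))) =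
      (diag_coeff (- s) (fst l) - lower_dot (- s) (fst l) y) *
        ((- 1) ^ Suc (count_list (map fst w) 1) * alexander_value s (rev (map fst w)))"
      using det_loop_form_Cons[OF Cons.prems(1) _ _ y(1)[rule_format]] s l types Cons.IH[OF w ne last True]
      by auto
    also have "\<dots> = (- 1) ^ Suc (count_list (map fst w) 1) *
        ((if fst l = 1 then - 1 else 1) * alexander_value s (rev (map fst w) @ [fst l]))"
      by (simp only: y(2)[symmetric] ac_simps)
    finally show ?thesis using l by auto
  next
    case False
    \<comment> \<open>Here \<open>l\<close> is the only letter of generator 1: it opens no loop, and
      the loops are those of a block of letters of generator 2.\<close>
    then have l1: "l = (1, 1)" using Cons.prems(4) l by auto
    have "x = (2, - 1)" if "x \<in> set w" for x
      using that w False by (force simp: alternating_letters_def)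
    then obtain q where q: "w = replicate (Suc q) (2, - 1)"
      using ne by (metis length_greater_0_conv gr0_implies_Suc replicate_eqI)
    let ?J = "replicate (Suc q) (2 :: nat)"
    have cnt: "count_list (?J @ [1]) 1 = 1" "count_list (?J @ [1]) 2 = Suc q"
      by (induction q) auto
    have tr: "(1 - s) * burau_trace s (?J @ [1]) = (1 - s) + (s * (1 - s ^ Suc q) + (1 - s) * s ^ Suc q * s)"
      using burau_prod_replicate_2[of s "Suc q" 1 0] burau_prod_replicate_2[of s "Suc q" s s]
      by (simp add: burau_trace_def burau_prod_append burau_mult_def algebra_simps
          del: replicate_Suc power_Suc)
    have "(1 - s) * (burau_trace s (?J @ [1]) - s - s ^ Suc q) = (1 - s ^ Suc q) * (1 - s + s\<^sup>2)"
      using tr by (simp add: algebra_simps power2_eq_square del: replicate_Suc power_Suc)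
    then have "alexander_value s (?J @ [1]) = (1 - s ^ Suc q) / (1 - s)"
      using cyclotomic_pos[of s] s unfolding alexander_value_def cnt
      by (simp add: field_simps del: replicate_Suc power_Suc)
    moreover have "det (list_mat (braid_loops (l # w)) (loop_form (- s) (l # w))) =
        det (list_mat (braid_loops w) (loop_form (- s) w))"
      using False l1 by (simp add: braid_loops_Cons list_mat_braid_loops_Cons)
    moreover have "rev (map fst (l # w)) = ?J @ [1]" "count_list (map fst (l # w)) 1 = 1"
      using l1 False by (auto simp: q map_replicate_const rev_replicate count_list_0_iff
          simp del: replicate_Suc)
    ultimately show ?thesis
      using det_loop_form_replicate[OF s, of q] unfolding q by simp
  qed
qed simp

section \<open>Positivity and symmetry of the coefficients\<close>

abbreviation indet :: "real poly" where "indet \<equiv> [:0, 1:]"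

lemma coeff_indet_mult: "coeff (indet * p) i = (if i = 0 then 0 else coeff p (i - 1))"
  by (cases i) auto

definition full_support :: "real poly \<Rightarrow> nat \<Rightarrow> bool" where
  "full_support p d \<longleftrightarrow> (\<forall>i\<le>d. coeff p i > 0) \<and> (\<forall>i>d. coeff p i = 0)"

lemma full_support_nonneg: "full_support p d \<Longrightarrow> coeff p i \<ge> 0"
  unfolding full_support_def by (cases "i \<le> d") (auto intro: less_imp_le)

lemma full_support_add_indet_mult:
  assumes p: "full_support p d" and q: "full_support q e"
  shows "full_support (p + indet * q) (max d (Suc e))"
  unfolding full_support_def coeff_add
proof (intro conjI allI impI)
  have nonneg: "coeff p i \<ge> 0" "coeff (indet * q) i \<ge> 0" for i
    using full_support_nonneg[OF p] full_support_nonneg[OF q] unfolding coeff_indet_mult by auto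
  fix i assume "i \<le> max d (Suc e)"
  then consider "i \<le> d" | "i > d" "i \<noteq> 0" "i - 1 \<le> e" by linarith
  then show "coeff p i + coeff (indet * q) i > 0"
  proof cases
    case 1
    then have "coeff p i > 0" using p by (simp add: full_support_def)
    then show ?thesis using nonneg(2)[of i] by linarith
  next
    case 2
    then have "coeff (indet * q) i > 0"
      using q unfolding coeff_indet_mult by (simp add: full_support_def)
    then show ?thesis using nonneg(1)[of i] by linarith
  qed
next
  fix i assume "i > max d (Suc e)"
  then have "i > d" "i - 1 > e" by auto
  then have "coeff p i = 0" "coeff (indet * q) i = 0"
    using p q unfolding coeff_indet_mult by (simp_all add: full_support_def)
  then show "coeff p i + coeff (indet * q) i = 0" by linarith
qed

text \<open>A letter 1 turns \<open>x\<close> into \<open>x + indet * y\<close>, so both polynomials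
  must be followed together. The second entry \<open>y\<close> may have gaps, and only its
  nonnegativity is carried along.\<close>

lemma burau_prod_full_support:
  assumes "set is \<subseteq> {1, 2}"
  defines "x \<equiv> fst (burau_prod indet is (1, 0))" and "y \<equiv> snd (burau_prod indet is (1, 0))"
  shows "\<exists>d e. full_support x d \<and> full_support (x + indet * y) e \<and> (\<forall>i. coeff y i \<ge> 0) \<and>
     d \<le> length is \<and> e \<le> Suc (length is)"
  using assms(1) unfolding x_def y_def
proof (induction "is")
  case Nil
  have "full_support 1 0" by (auto simp: full_support_def)
  then show ?case by auto
next
  case (Cons i "is")
  define x y where "x = fst (burau_prod indet is (1, 0))" and "y = snd (burau_prod indet is (1, 0))"
  obtain d e where *: "full_support x d" "full_support (x + indet * y) e" "\<And>i. coeff y i \<ge> 0"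
     "d \<le> length is" "e \<le> Suc (length is)"
    using Cons unfolding x_def y_def by auto
  let ?v = "x + indet * y"
  have x0: "coeff x i \<ge> 0" for i
    using full_support_nonneg[OF *(1)] .
  show ?case
  proof (cases "i = 1")
    case True
    have nonneg: "coeff (indet * y) i \<ge> 0" for i
      using *(3) unfolding coeff_indet_mult by simp
    \<comment> \<open>Both summands are nonnegative, so nothing cancels beyond degree
      \<open>e\<close>.\<close>
    have 0: "coeff (indet * y) i = 0" if "i > e" for i
    proof -
      have "coeff x i + coeff (indet * y) i = 0"
        using *(2) that unfolding full_support_def coeff_add by blast
      then show ?thesis using x0[of i] nonneg[of i] by linarith
    qed
    define u where "u = indet * (indet * y)"
    have u: "coeff u i \<ge> 0" "i > Suc e \<Longrightarrow> coeff u i = 0" for i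
      unfolding u_def coeff_indet_mult[of "indet * y"] using nonneg 0[of "i - 1"] by auto
    \<comment> \<open>The support of \<open>u\<close> reaches at most \<open>Suc e\<close>; whether
      that coefficient is nonzero decides the new degree.\<close>
    define m where "m = (if coeff u (Suc e) = 0 then e else Suc e)"
    have v: "i \<le> e \<Longrightarrow> coeff ?v i > 0" "i > e \<Longrightarrow> coeff ?v i = 0" for i
      using *(2) unfolding full_support_def by blast+
    have full: "full_support (?v + u) m"
      unfolding full_support_def coeff_add[of ?v u]
    proof (intro conjI allI impI)
      fix i assume i: "i \<le> m"
      show "coeff ?v i + coeff u i > 0"
      proof (cases "i \<le> e")
        case True
        then show ?thesis using v(1)[of i] u(1)[of i] by linarith
      next
        case False
        then have "i = Suc e" "coeff u (Suc e) \<noteq> 0" using i by (auto simp: m_def split: if_splits)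
        then show ?thesis using v(2)[of i] u(1)[of i] by auto
      qed
    next
      fix i assume i: "i > m"
      then have "i > e" "coeff u i = 0"
        using u(2)[of i] by (cases "i = Suc e"; auto simp: m_def split: if_splits)+
      then show "coeff ?v i + coeff u i = 0" using v(2)[of i] by linarith
    qed
    have m: "m \<le> Suc e" by (simp add: m_def)
    have prod: "fst (burau_prod indet (i # is) (1, 0)) = ?v"
      "snd (burau_prod indet (i # is) (1, 0)) = indet * y"
      using True by (simp_all add: burau_mult_def x_def y_def)
    show ?thesis
      unfolding prod
    proof (intro exI conjI)
      show "full_support ?v e" by fact
      show "full_support (?v + indet * (indet * y)) m" using full unfolding u_def .
      show "\<forall>i. coeff (indet * y) i \<ge> 0" using nonneg by blast
      show "e \<le> length (i # is)" using *(5) by simp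
      show "m \<le> Suc (length (i # is))" using *(5) m by simp
    qed
  next
    case False
    have prod: "fst (burau_prod indet (i # is) (1, 0)) = x"
      "snd (burau_prod indet (i # is) (1, 0)) = ?v"
      using False by (simp_all add: burau_mult_def x_def y_def)
    have "coeff ?v i \<ge> 0" for i
      using full_support_nonneg[OF *(2)] .
    then have nonneg: "\<forall>i. coeff ?v i \<ge> 0" by blast
    show ?thesis
      unfolding prod
    proof (intro exI conjI)
      show "full_support x d" by fact
      show "full_support (x + indet * ?v) (max d (Suc e))"
        by (rule full_support_add_indet_mult[OF *(1,2)])
      show "\<forall>i. coeff ?v i \<ge> 0" by fact
      show "d \<le> length (i # is)" using *(4) by simp
      show "max d (Suc e) \<le> Suc (length (i # is))" using *(4,5) by simp
    qed
  qed
qed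

text \<open>
  The polynomial \<open>X\<close> with \<open>(1 - s) f(s) = X(s) + O(s\<^sup>p)\<close>, where \<open>p\<close> is the length of the long block
  of letters \<open>\<sigma>\<^sub>1\<close> and \<open>f(s)\<close> the Alexander polynomial at \<open>- s\<close> up to sign.
\<close>

fun leading_part :: "nat list \<Rightarrow> real poly" where
  "leading_part [] = 0"
| "leading_part (i # is) =
    (if i = 1 then leading_part is
     else fst (burau_prod indet is (1, 0)) + indet * leading_part is)"

lemma leading_part_eq_0: "set is \<subseteq> {1} \<Longrightarrow> leading_part is = 0"
  by (induction "is") auto

text \<open>Each letter 2 shifts the previous polynomial and adds one of full support, so the degree
  grows by at least one per letter 2 after the first contribution. The lower bound on
  \<open>d\<close> serves the signature, the upper bound the plateau.\<close>

lemma leading_part_full_support: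
  assumes "set is \<subseteq> {1, 2}" "2 \<in> set is"
  shows "\<exists>d. full_support (leading_part is) d \<and> count_list is 2 \<le> Suc d \<and> d < length is"
  using assms
proof (induction "is")
  case (Cons i "is")
  show ?case
  proof (cases "i = 1")
    case True
    then show ?thesis using Cons by auto
  next
    case False
    then have i: "i = 2" using Cons.prems by auto
    obtain e where e: "full_support (fst (burau_prod indet is (1, 0))) e" "e \<le> length is"
      using burau_prod_full_support[of "is"] Cons.prems by auto
    show ?thesis
    proof (cases "2 \<in> set is")
      case True
      then obtain d where d: "full_support (leading_part is) d" "count_list is 2 \<le> Suc d" "d < length is"
        using Cons by auto
      then show ?thesis
        using full_support_add_indet_mult[OF e(1) d(1)] e(2) i by (intro exI[of _ "max e (Suc d)"]) auto
    next
      case False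
      moreover have "leading_part is = 0" using False Cons.prems by (intro leading_part_eq_0) auto
      ultimately show ?thesis
        using e i by (intro exI[of _ e]) (auto simp: count_list_0_iff)
    qed
  qed
qed simp

text \<open>The right side is, modulo \<open>indet ^ p\<close>, \<open>1 - indet\<close> times the
  numerator of \<open>alexander_value\<close> for the list followed by \<open>p\<close> letters 1. A
  letter 1 in front leaves it unchanged, which explains the first clause of the recursion.\<close>

lemma leading_part_eq:
  assumes "set is \<subseteq> {1, 2}"
  shows "(1 - indet + indet\<^sup>2) * leading_part is =
    (1 - indet) * fst (burau_prod indet is (1, 0)) + indet * snd (burau_prod indet is (1, 0)) -
    (1 - indet) * indet ^ count_list is 2"
  using assms
proof (induction "is")
  case (Cons i "is")
  define X where "X = indet"
  define x y where "x = fst (burau_prod X is (1, 0))" and "y = snd (burau_prod X is (1, 0))"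
  have IH: "(1 - X + X\<^sup>2) * leading_part is = (1 - X) * x + X * y - (1 - X) * X ^ count_list is 2"
    using Cons by (simp add: x_def y_def X_def)
  show ?case
  proof (cases "i = 1")
    case True
    have "(1 - X) * (x + X * y) + X * (X * y) = (1 - X) * x + X * y"
      by (simp add: algebra_simps)
    then show ?thesis
      using True IH unfolding X_def[symmetric] by (simp add: burau_mult_def flip: x_def y_def)
  next
    case False
    then have i: "i = 2" using Cons.prems by auto
    have "(1 - X + X\<^sup>2) * (x + X * leading_part is) =
        (1 - X + X\<^sup>2) * x + X * ((1 - X + X\<^sup>2) * leading_part is)" by (simp add: algebra_simps)
    also have "\<dots> = (1 - X) * x + X * (x + X * y) - (1 - X) * X ^ Suc (count_list is 2)"
      unfolding IH by (simp add: algebra_simps power2_eq_square)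
    finally show ?thesis
      using i unfolding leading_part.simps X_def[symmetric]
      by (simp add: burau_mult_def flip: x_def y_def)
  qed
qed simp

section \<open>From values to coefficients: truncation and symmetry\<close>

lemma poly_burau_prod:
  "poly (fst (burau_prod indet is (p, q))) s = fst (burau_prod s is (poly p s, poly q s))"
  "poly (snd (burau_prod indet is (p, q))) s = snd (burau_prod s is (poly p s, poly q s))"
  by (induction "is") (auto simp: burau_mult_def)

text \<open>The geometric sum is cleared of its denominator \<open>1 - s\<close>, so that the
  formula also applies to \<open>s = indet\<close>.\<close>

lemma burau_prod_replicate_1:
  "(1 - s) * fst (burau_prod s (replicate p 1) (x, y)) = (1 - s) * x + s * (1 - s ^ p) * y \<and>
   snd (burau_prod s (replicate p 1) (x, y)) = s ^ p * y"
proof (induction p)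
  case (Suc p)
  let ?v = "burau_prod s (replicate p 1) (x, y)"
  have "(1 - s) * (fst ?v + s * snd ?v) = (1 - s) * fst ?v + s * (1 - s) * snd ?v"
    by (simp add: algebra_simps)
  also have "\<dots> = (1 - s) * x + s * (1 - s ^ Suc p) * y"
    unfolding Suc.IH[THEN conjunct1] Suc.IH[THEN conjunct2] by (simp add: algebra_simps)
  finally show ?case using Suc.IH by (simp add: burau_mult_def)
qed simp

text \<open>Modulo \<open>s ^ p\<close> the block of letters 1 acts as
  \<open>(1, s / (1 - s); 0, 0)\<close>, and the trace sees only the first column of the matrix of
  \<open>is\<close>.\<close>

lemma burau_trace_append_replicate:
  "\<exists>r. (1 - s) * burau_trace s (is @ replicate p 1) =
    (1 - s) * fst (burau_prod s is (1, 0)) + s * snd (burau_prod s is (1, 0)) + s ^ p * r"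
proof -
  define x z where "x = fst (burau_prod s (replicate p 1) (1, 0))"
    and "z = fst (burau_prod s (replicate p 1) (0, 1))"
  have xz: "(1 - s) * x = 1 - s" "(1 - s) * z = s * (1 - s ^ p)"
    using burau_prod_replicate_1[of s p 1 0] burau_prod_replicate_1[of s p 0 1]
    by (simp_all add: x_def z_def)
  have "burau_prod s (replicate p 1) (1, 0) = (x, 0)"
     "burau_prod s (replicate p 1) (0, 1) = (z, s ^ p)"
    by (simp_all add: x_def z_def prod_eq_iff burau_prod_replicate_1[THEN conjunct2, unfolded One_nat_def])
  then have "burau_trace s (is @ replicate p 1) =
      x * fst (burau_prod s is (1, 0)) + z * snd (burau_prod s is (1, 0)) +
      s ^ p * snd (burau_prod s is (0, 1))"
    by (simp add: burau_trace_def burau_prod_append burau_prod_linear[of s "is" x 0]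
        burau_prod_linear[of s "is" z "s ^ p"])
  then have "(1 - s) * burau_trace s (is @ replicate p 1) =
      ((1 - s) * x) * fst (burau_prod s is (1, 0)) + ((1 - s) * z) * snd (burau_prod s is (1, 0)) +
      s ^ p * ((1 - s) * snd (burau_prod s is (0, 1)))"
    by (simp add: algebra_simps)
  then show ?thesis unfolding xz
    by (intro exI[of _ "(1 - s) * snd (burau_prod s is (0, 1)) - s * snd (burau_prod s is (1, 0))"])
      (simp add: algebra_simps)
qed

text \<open>Carries identities known for real \<open>s\<close> between 0 and 1 over to
  polynomials.\<close>

lemma poly_eqI_interval:
  fixes p q :: "real poly"
  assumes "\<And>x. 0 < x \<Longrightarrow> x < 1 \<Longrightarrow> poly p x = poly q x"
  shows "p = q"
proof (rule ccontr)
  assume "p \<noteq> q"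
  then have "finite {x. poly (p - q) x = 0}" by (intro poly_roots_finite) simp
  moreover have "{0<..<1} \<subseteq> {x. poly (p - q) x = 0}" using assms by auto
  ultimately have "finite {0<..<1 :: real}" using finite_subset by blast
  then show False using infinite_Ioo[of "0 :: real" 1] by simp
qed

text \<open>\<open>V - t V^T\<close> is \<open>- t\<close> times the transpose of
  \<open>V - t^(-1) V^T\<close>.\<close>

lemma poly_Alexander_polynomial_inverse:
  assumes "t \<noteq> 0"
  shows "poly (map_poly real_of_int (Alexander_polynomial w)) t =
    (- t) ^ length (braid_loops w) * poly (map_poly real_of_int (Alexander_polynomial w)) (inverse t)"
proof -
  let ?L = "braid_loops w"
  let ?h = "\<lambda>t x z. real_of_int (loop_linking w x z) - t * real_of_int (loop_linking w z x)"
  have "list_mat ?L (?h t) = (- t) \<cdot>\<^sub>m transpose_mat (list_mat ?L (?h (inverse t)))"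
    using assms by (auto simp: list_mat_def field_simps intro!: eq_matI)
  then have "det (list_mat ?L (?h t)) =
      (- t) ^ length ?L * det (transpose_mat (list_mat ?L (?h (inverse t))))"
    by (simp add: list_mat_def)
  then show ?thesis
    unfolding poly_Alexander_polynomial det_transpose[OF list_mat_carrier] .
qed

text \<open>The hypothesis compares shifts of \<open>p\<close> and of its reflection. Both have
  nonzero constant coefficient, so the shifts agree.\<close>

lemma palindromic_polyI:
  fixes p :: "real poly"
  assumes "\<And>x. x \<noteq> 0 \<Longrightarrow> poly p x = x ^ n * poly p (inverse x)" and "coeff p 0 \<noteq> 0"
  shows "degree p = n" "i \<le> n \<Longrightarrow> coeff p (n - i) = coeff p i"
proof -
  have eq: "monom 1 (degree p) * p = monom 1 n * reflect_poly p"
  proof (rule poly_eqI_interval)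
    fix x :: real assume "0 < x" "x < 1"
    then show "poly (monom 1 (degree p) * p) x = poly (monom 1 n * reflect_poly p) x"
      using assms(1)[of x] by (simp add: poly_monom poly_reflect_poly_nz)
  qed
  show deg: "degree p = n"
  proof (rule linorder_cases)
    assume "degree p < n"
    then show ?thesis
      using arg_cong[OF eq, of "\<lambda>q. coeff q (degree p)"] assms(2) by (simp add: coeff_monom_mult)
  next
    assume "n < degree p"
    then show ?thesis
      using arg_cong[OF eq, of "\<lambda>q. coeff q n"] by (simp add: coeff_monom_mult coeff_reflect_poly)
  qed
  have "reflect_poly p = p" using eq deg by simp
  then show "coeff p (n - i) = coeff p i" if "i \<le> n"
    using that deg by (metis coeff_reflect_poly not_le)
qed

text \<open>\<open>1 - indet + indet^2\<close> has constant term 1 and can be cancelled modulo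
  \<open>indet ^ p\<close>.\<close>

lemma coeff_eq_below:
  fixes g :: "real poly"
  assumes "(1 - indet + indet\<^sup>2) * g = indet ^ p * r" "k < p"
  shows "coeff g k = 0"
  using assms(2)
proof (induction k rule: less_induct)
  case (less k)
  have "indet ^ p = monom 1 p" using monom_altdef[of "1 :: real" p] by (simp only: smult_1_left)
  then have "coeff (indet ^ p * r) k = 0" using less.prems by (simp add: coeff_monom_mult)
  moreover have "indet ^ p * r = g - indet * g + indet * (indet * g)"
    unfolding assms(1)[symmetric] by (simp only: algebra_simps power2_eq_square mult_1_left)
  ultimately have "coeff g k - coeff (indet * g) k + coeff (indet * (indet * g)) k = 0"
    by (simp only: coeff_add coeff_diff)
  then have "coeff g k = coeff (indet * g) k - coeff (indet * (indet * g)) k" by linarith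
  also have "\<dots> = 0" unfolding coeff_indet_mult using less by auto
  finally show ?case .
qed

text \<open>Every letter opens a loop, except the last occurrence of each generator.\<close>

lemma length_braid_loops: "length (braid_loops w) + card (fst ` set w) = length w"
  by (induction w) (auto simp: braid_loops_Cons card_insert_if)

text \<open>\<open>F\<close> lists the coefficients after the substitution \<open>t = - s\<close>,
  with the sign from \<open>det_loop_form\<close> removed. Since \<open>N < 2 * p\<close>, each
  index up to \<open>N\<close> or its mirror image lies below \<open>p\<close>, where
  \<open>X\<close> controls the coefficients.\<close>

lemma Alexander_polynomial_coeffs:
  fixes u :: braid_word and p :: nat
  defines "w \<equiv> replicate p (1, 1) @ u"
  defines "N \<equiv> length (braid_loops w)"
  defines "F \<equiv> \<lambda>i. (- 1) ^ Suc (count_list (map fst w) 1) * (- 1) ^ i *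
    coeff (Alexander_polynomial w) i"
  assumes u: "alternating_letters u" "u \<noteq> []" "last u = (2, - 1)" and p: "length u + 6 \<le> p"
  obtains d where "count_list (map fst u) 2 \<le> Suc d" "d < length u" "N + 2 = p + length u"
    "\<And>i. i \<le> N \<Longrightarrow> F i > 0" "\<And>i. i > N \<Longrightarrow> F i = 0"
    "\<And>i. i < d \<Longrightarrow> F i < F (Suc i)" "\<And>i. d \<le> i \<Longrightarrow> i \<le> N - d \<Longrightarrow> F i = F d"
    "\<And>i. i \<le> N \<Longrightarrow> F (N - i) = F i"
proof -
  let ?A = "map_poly real_of_int (Alexander_polynomial w)"
  define J where "J = rev (map fst u)"
  define P where "P = count_list (map fst w) 1"
  define sg :: real where "sg = (- 1) ^ Suc P"
  \<comment> \<open>The real polynomial in \<open>s\<close> with coefficients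
    \<open>F\<close>.\<close>
  define G where "G = Polynomial.smult sg (pcompose ?A [:0, - 1:])"
  have coeff_G: "coeff G i = real_of_int (F i)" for i
    by (simp add: G_def F_def sg_def P_def coeff_pcompose_linear coeff_map_poly)
  have w: "alternating_letters w" "w \<noteq> []" "last w = (2, - 1)"
    using u p by (auto simp: w_def alternating_letters_def)
  have types: "fst ` set w = {1, 2}"
  proof
    show "fst ` set w \<subseteq> {1, 2}" using w(1) by (auto simp: alternating_letters_def)
    have "(2, - 1) \<in> set w" using w(2,3) last_in_set by metis
    moreover have "(1, 1) \<in> set w" using p by (simp add: w_def)
    ultimately show "{1, 2} \<subseteq> fst ` set w" by force
  qed
  have N: "N + 2 = p + length u"
    using length_braid_loops[of w] unfolding types by (simp add: N_def w_def)
  have J: "set J \<subseteq> {1, 2}" using u(1) by (auto simp: J_def alternating_letters_def)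
  have J2: "2 \<in> set J"
    using last_in_set[OF u(2)] u(3) by (force simp: J_def)
  have rev_w: "rev (map fst w) = J @ replicate p 1"
    by (simp add: w_def J_def)
  have cnt: "count_list (rev (map fst w)) i = count_list (map fst w) i" for i by simp
  have sg: "sg * sg = 1" by (simp add: sg_def flip: power_mult_distrib)
  have val: "poly G s = alexander_value s (J @ replicate p 1)" if "0 < s" "s < 1" for s
  proof -
    have "1 \<in> fst ` set w" unfolding types by simp
    from det_loop_form[OF w this that]
    have "poly ?A (- s) = sg * alexander_value s (J @ replicate p 1)"
      unfolding det_loop_form_eq_poly[OF w(1)] rev_w sg_def P_def .
    then have "poly G s = (sg * sg) * alexander_value s (J @ replicate p 1)"
      by (simp add: G_def poly_pcompose)
    then show ?thesis unfolding sg by simp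
  qed
  define Q where "Q = count_list J 2"
  define R where "R = count_list J 1"
  have PQ: "count_list (J @ replicate p 1) 1 = R + p" "count_list (J @ replicate p 1) 2 = Q"
    by (induction p) (auto simp: Q_def R_def)
  have poly_trace: "poly (burau_trace indet is) s = burau_trace s is" for "is" s
    by (simp add: burau_trace_def poly_burau_prod)
  have G_eq: "(1 - indet + indet\<^sup>2) * G =
      burau_trace indet (J @ replicate p 1) - indet ^ (R + p) - indet ^ Q"
  proof (rule poly_eqI_interval)
    fix s :: real assume s: "0 < s" "s < 1"
    show "poly ((1 - indet + indet\<^sup>2) * G) s =
      poly (burau_trace indet (J @ replicate p 1) - indet ^ (R + p) - indet ^ Q) s"
      using val[OF s, unfolded alexander_value_def PQ] cyclotomic_pos[of s]
      by (simp add: poly_trace)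
  qed
  define X where "X = leading_part J"
  obtain r where r: "(1 - indet) * burau_trace indet (J @ replicate p 1) =
     (1 - indet) * fst (burau_prod indet J (1, 0)) + indet * snd (burau_prod indet J (1, 0)) +
     indet ^ p * r"
    using burau_trace_append_replicate[of indet J p] by auto
  have X: "(1 - indet + indet\<^sup>2) * X =
    (1 - indet) * fst (burau_prod indet J (1, 0)) + indet * snd (burau_prod indet J (1, 0)) -
    (1 - indet) * indet ^ Q"
    unfolding X_def Q_def by (rule leading_part_eq[OF J])
  \<comment> \<open>All terms in which \<open>(1 - indet) * G\<close> and \<open>X\<close> differ,
    after clearing the denominator, carry the factor \<open>indet ^ p\<close>.\<close>
  have "(1 - indet + indet\<^sup>2) * ((1 - indet) * G - X) =
      (1 - indet) * ((1 - indet + indet\<^sup>2) * G) - (1 - indet + indet\<^sup>2) * X"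
    by (simp only: algebra_simps)
  also have "\<dots> = indet ^ p * (r - (1 - indet) * indet ^ R)"
    unfolding G_eq X by (simp only: right_diff_distrib r power_add) (simp only: algebra_simps)
  finally have below: "coeff ((1 - indet) * G - X) k = 0" if "k < p" for k
    using coeff_eq_below that by blast
  have step: "coeff G k = (if k = 0 then 0 else coeff G (k - 1)) + coeff X k" if "k < p" for k
  proof -
    have "(1 - indet) * G = G - indet * G" by (simp only: algebra_simps mult_1_left)
    then show ?thesis using below[OF that] coeff_indet_mult[of G k] by (simp only: coeff_diff)
  qed
  obtain d where d: "full_support X d" "Q \<le> Suc d" "d < length J"
    using leading_part_full_support[OF J J2] unfolding X_def Q_def by blast
  have Xpos: "coeff X i > 0" if "i \<le> d" for i using d(1) that by (simp add: full_support_def)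
  have X0: "coeff X i = 0" if "i > d" for i using d(1) that by (simp add: full_support_def)
  have dp: "d < p" using d(3) p by (simp add: J_def)
  have inc: "F i < F (Suc i)" if "i < d" for i
    using step[of "Suc i"] Xpos[of "Suc i"] that dp by (simp add: coeff_G)
  have const: "F (d + j) = F d" if "d + j < p" for j
    using that
  proof (induction j)
    case (Suc j)
    then show ?case using step[of "d + Suc j"] X0[of "d + Suc j"] by (simp add: coeff_G)
  qed simp
  have F0: "F 0 > 0" using step[of 0] Xpos[of 0] p by (simp add: coeff_G)
  have Fpos: "F i > 0" if "i \<le> d" for i
    using that
  proof (induction i)
    case (Suc i)
    then show ?case using inc[of i] by simp
  qed (use F0 in simp)
  have Fp: "F i > 0" if "i < p" for i
    using Fpos[of i] Fpos[of d] const[of "i - d"] that by (cases "i \<le> d") auto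
  \<comment> \<open>At \<open>t = - s\<close> the factor \<open>(- t) ^ N\<close> becomes
    \<open>s ^ N\<close>, so the symmetry of \<open>G\<close> has no signs.\<close>
  have palin: "poly G s = s ^ N * poly G (inverse s)" if "s \<noteq> 0" for s
    using poly_Alexander_polynomial_inverse[of "- s" w] that
    by (simp add: G_def poly_pcompose N_def)
  have G0: "coeff G 0 \<noteq> 0" using F0 unfolding coeff_G by simp
  have degN: "degree G = N" by (rule palindromic_polyI(1)[OF palin G0])
  have sym: "i \<le> N \<Longrightarrow> coeff G (N - i) = coeff G i" for i
    by (rule palindromic_polyI(2)[OF palin G0])
  have symF: "F (N - i) = F i" if "i \<le> N" for i
    using sym[OF that] by (simp add: coeff_G)
  show ?thesis
  proof (rule that[of d])
    show "count_list (map fst u) 2 \<le> Suc d" "d < length u"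
      using d(2,3) by (simp_all add: J_def Q_def)
    show "F i > 0" if "i \<le> N" for i
    proof (cases "i < p")
      case False
      then have "N - i < p" using N p that by linarith
      then show ?thesis using symF[OF that] Fp by metis
    qed (use Fp in simp)
    show "F i = 0" if "i > N" for i
      using coeff_G[of i] coeff_eq_0[of G i] degN that by simp
    show "F i = F d" if i: "d \<le> i" "i \<le> N - d" for i
    proof (cases "i < p")
      case True
      then show ?thesis using const[of "i - d"] i by simp
    next
      case False
      have le: "i \<le> N" using i by linarith
      have le': "d \<le> N - i" and "N - i < p" using i False N p d(3) by (auto simp: J_def)
      then have "F (N - i) = F d"
        using const[of "N - i - d", unfolded le_add_diff_inverse[OF le']] by blast
      then show ?thesis using symF[OF le] by simp
    qed
  qed (use inc symF N in auto)
qed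

section \<open>Signatures of real symmetric matrices\<close>

lemma smult_mult_mat_vec:
  fixes A :: "'a :: comm_ring_1 mat"
  assumes "A \<in> carrier_mat n n" "v \<in> carrier_vec n"
  shows "A *\<^sub>v (c \<cdot>\<^sub>v v) = c \<cdot>\<^sub>v (A *\<^sub>v v)"
  using assms by (intro eq_vecI) auto

lemma symmetric_scalar_prod:
  fixes A :: "'a :: comm_ring_1 mat"
  assumes "A \<in> carrier_mat n n" "transpose_mat A = A" "v \<in> carrier_vec n" "w \<in> carrier_vec n"
  shows "v \<bullet> (A *\<^sub>v w) = (A *\<^sub>v v) \<bullet> w"
  using assms transpose_vec_mult_scalar[of A n n w v] by (simp add: comm_scalar_prod[of _ n])

lemma scalar_prod_self_nonneg: "(v :: real vec) \<bullet> v \<ge> 0"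
  by (auto simp: scalar_prod_def intro!: sum_nonneg)

lemma scalar_prod_self_eq_0:
  assumes "(v :: real vec) \<in> carrier_vec n" "v \<bullet> v = 0"
  shows "v = 0\<^sub>v n"
  using assms by (intro eq_vecI) (auto simp: scalar_prod_def sum_nonneg_eq_0_iff)

text \<open>For a complex eigenvector \<open>x + i y\<close> with eigenvalue \<open>a + i b\<close>,
  symmetry gives \<open>b * (x \<bullet> x + y \<bullet> y) = 0\<close>. Hence \<open>b = 0\<close>,
  and \<open>x\<close> or \<open>y\<close> is a real eigenvector.\<close>

lemma symmetric_real_eigenvector:
  fixes A :: "real mat"
  assumes A: "A \<in> carrier_mat n n" and sym: "transpose_mat A = A" and n: "n > 0"
  obtains v e where "v \<in> carrier_vec n" "v \<bullet> v = 1" "A *\<^sub>v v = e \<cdot>\<^sub>v v"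
proof -
  let ?C = "map_mat complex_of_real A"
  have C: "?C \<in> carrier_mat n n" using A by simp
  obtain k where "eigenvalue ?C k"
    using spectrum_non_empty[OF C n] unfolding spectrum_def by auto
  then obtain z where z: "z \<in> carrier_vec n" "z \<noteq> 0\<^sub>v n" "?C *\<^sub>v z = k \<cdot>\<^sub>v z"
    unfolding eigenvalue_def eigenvector_def using A by auto
  define x y where "x = map_vec Re z" and "y = map_vec Im z"
  define a b where "a = Re k" and "b = Im k"
  have xy: "x \<in> carrier_vec n" "y \<in> carrier_vec n" using z by (auto simp: x_def y_def)
  have Az: "(\<Sum>j = 0..<n. complex_of_real (A $$ (i, j)) * z $ j) = k * z $ i" if "i < n" for i
    using arg_cong[OF z(3), of "\<lambda>v. v $ i"] that z(1) A
    by (simp add: scalar_prod_def)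
  have "A *\<^sub>v x = a \<cdot>\<^sub>v x - b \<cdot>\<^sub>v y"
  proof (rule eq_vecI)
    fix i assume "i < dim_vec (a \<cdot>\<^sub>v x - b \<cdot>\<^sub>v y)"
    then have i: "i < n" using xy by simp
    show "(A *\<^sub>v x) $ i = (a \<cdot>\<^sub>v x - b \<cdot>\<^sub>v y) $ i"
      using arg_cong[OF Az[OF i], of Re] i z(1) A
      by (simp add: scalar_prod_def x_def y_def a_def b_def)
  qed (use A xy in simp)
  moreover have "A *\<^sub>v y = b \<cdot>\<^sub>v x + a \<cdot>\<^sub>v y"
  proof (rule eq_vecI)
    fix i assume "i < dim_vec (b \<cdot>\<^sub>v x + a \<cdot>\<^sub>v y)"
    then have i: "i < n" using xy by simp
    show "(A *\<^sub>v y) $ i = (b \<cdot>\<^sub>v x + a \<cdot>\<^sub>v y) $ i"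
      using arg_cong[OF Az[OF i], of Im] i z(1) A
      by (simp add: scalar_prod_def x_def y_def a_def b_def)
  qed (use A xy in simp)
  moreover have "y \<bullet> (A *\<^sub>v x) = (A *\<^sub>v y) \<bullet> x"
    using symmetric_scalar_prod[OF A sym] xy by simp
  ultimately have "b * (x \<bullet> x + y \<bullet> y) = 0"
    using xy by (simp add: scalar_prod_minus_distrib[of _ n] add_scalar_prod_distrib[of _ n]
        comm_scalar_prod[of y n x] algebra_simps)
  moreover have nz: "x \<bullet> x + y \<bullet> y \<noteq> 0"
  proof
    assume "x \<bullet> x + y \<bullet> y = 0"
    then have "x \<bullet> x = 0" "y \<bullet> y = 0"
      using scalar_prod_self_nonneg[of x] scalar_prod_self_nonneg[of y] by linarith+
    then have "x = 0\<^sub>v n" "y = 0\<^sub>v n" using scalar_prod_self_eq_0 xy by blast+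
    moreover have "Re (z $ i) = x $ i" "Im (z $ i) = y $ i" if "i < n" for i
      using that z(1) by (simp_all add: x_def y_def)
    ultimately have "Re (z $ i) = 0" "Im (z $ i) = 0" if "i < n" for i
      using that by simp_all
    then have "z = 0\<^sub>v n" using z(1) by (intro eq_vecI) (auto simp: complex_eq_iff)
    then show False using z(2) by simp
  qed
  ultimately have b: "b = 0" by simp
  have eig: "A *\<^sub>v x = a \<cdot>\<^sub>v x" "A *\<^sub>v y = a \<cdot>\<^sub>v y"
    using \<open>A *\<^sub>v x = _\<close> \<open>A *\<^sub>v y = _\<close> b xy by auto
  obtain u where u: "u \<in> carrier_vec n" "A *\<^sub>v u = a \<cdot>\<^sub>v u" "u \<bullet> u \<noteq> 0"
    using eig xy nz by (cases "x \<bullet> x = 0") auto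
  define c where "c = 1 / sqrt (u \<bullet> u)"
  have "u \<bullet> u > 0" using scalar_prod_self_nonneg[of u] u(3) by linarith
  then have "c * c * (u \<bullet> u) = 1" by (simp add: c_def)
  then have "(c \<cdot>\<^sub>v u) \<bullet> (c \<cdot>\<^sub>v u) = 1" using u(1) by simp
  moreover have "A *\<^sub>v (c \<cdot>\<^sub>v u) = a \<cdot>\<^sub>v (c \<cdot>\<^sub>v u)"
    using smult_mult_mat_vec[OF A u(1)] u by (simp add: smult_smult_assoc mult.commute)
  ultimately show ?thesis using that[of "c \<cdot>\<^sub>v u" a] u(1) by simp
qed

text \<open>The reflection in the hyperplane orthogonal to \<open>v - e\<^sub>0\<close>; it is the identity if \<open>v = e\<^sub>0\<close>.\<close>

lemma householder:
  fixes v :: "real vec"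
  assumes v: "v \<in> carrier_vec n" "v \<bullet> v = 1" and n: "n > 0"
  obtains H where "H \<in> carrier_mat n n" "transpose_mat H = H" "H * H = 1\<^sub>m n"
    "col H 0 = v"
proof -
  define u where "u = v - unit_vec n 0"
  \<comment> \<open>For \<open>u = 0\<close>, division by zero gives \<open>k = 0\<close>, so
    \<open>H\<close> is the identity without a case distinction.\<close>
  define k where "k = 2 / (u \<bullet> u)"
  define H where "H = mat n n (\<lambda>(i, j). (if i = j then 1 else 0) - k * (u $ i * u $ j))"
  have u: "u \<in> carrier_vec n" using v by (simp add: u_def)
  have H: "H \<in> carrier_mat n n" by (simp add: H_def)
  have uu: "u \<bullet> u = 2 - 2 * v $ 0"
    using v n by (simp add: u_def scalar_prod_minus_distrib[of _ n] minus_scalar_prod_distrib[of _ n])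
  have "H * H = 1\<^sub>m n"
  proof (rule eq_matI)
    fix i j assume "i < dim_row (1\<^sub>m n)" "j < dim_col (1\<^sub>m n)"
    then have ij: "i < n" "j < n" by auto
    \<comment> \<open>True for \<open>u = 0\<close> as well, because \<open>k = 0\<close>
      then.\<close>
    have kk: "k * (k * (u \<bullet> u)) = 2 * k" by (simp add: k_def)
    have "(H * H) $$ (i, j) = (\<Sum>l = 0..<n. ((if i = l then 1 else 0) - k * (u $ i * u $ l)) *
        ((if l = j then 1 else 0) - k * (u $ l * u $ j)))"
      using ij by (simp add: H_def scalar_prod_def)
    also have "\<dots> = (\<Sum>l = 0..<n. (if l = i then (if i = j then 1 else 0) - k * (u $ i * u $ j) else 0)
        - (if l = j then k * (u $ i * u $ j) else 0) + k * k * u $ i * u $ j * (u $ l * u $ l))"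
      by (intro sum.cong) (auto simp: algebra_simps)
    also have "\<dots> = (if i = j then 1 else 0) - k * (u $ i * u $ j) - k * (u $ i * u $ j) +
        k * k * u $ i * u $ j * (u \<bullet> u)"
      using ij u by (simp add: sum.distrib sum_subtractf sum_distrib_left[symmetric] scalar_prod_def)
    also have "\<dots> = (if i = j then 1 else 0) - 2 * k * (u $ i * u $ j) +
        (k * (k * (u \<bullet> u))) * (u $ i * u $ j)" by (simp add: algebra_simps)
    finally show "(H * H) $$ (i, j) = 1\<^sub>m n $$ (i, j)" unfolding kk using ij by simp
  qed (auto simp: H_def)
  moreover have "col H 0 = v"
  proof (rule eq_vecI)
    fix i assume "i < dim_vec v"
    then have i: "i < n" using v by simp
    have "k * u $ 0 * u $ i = - u $ i"
    proof (cases "u \<bullet> u = 0")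
      case True
      then have "u $ i = 0" using scalar_prod_self_eq_0[OF u] i by simp
      then show ?thesis by simp
    next
      case False
      have "u $ 0 = - (u \<bullet> u) / 2" using v n unfolding uu by (simp add: u_def field_simps)
      then show ?thesis using False by (simp add: k_def)
    qed
    then show "col H 0 $ i = v $ i"
      using i v n by (auto simp: H_def u_def algebra_simps)
  qed (use v in \<open>simp add: H_def\<close>)
  moreover have "transpose_mat H = H" by (auto simp: H_def intro!: eq_matI)
  ultimately show ?thesis using that H by blast
qed

text \<open>Deflation: conjugation by a reflection that takes \<open>e_0\<close> to a unit
  eigenvector splits off a \<open>1 x 1\<close> block, and by symmetry the rest of the first row
  vanishes too.\<close>

lemma symmetric_real_diagonalizable:
  fixes A :: "real mat"
  assumes "A \<in> carrier_mat n n" "transpose_mat A = A"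
  shows "\<exists>Q D. Q \<in> carrier_mat n n \<and> D \<in> carrier_mat n n \<and> diagonal_mat D \<and>
    transpose_mat Q * Q = 1\<^sub>m n \<and> A = Q * D * transpose_mat Q"
  using assms
proof (induction n arbitrary: A)
  case 0
  then show ?case
    by (intro exI[of _ "1\<^sub>m 0"] exI[of _ A]) (auto simp: diagonal_mat_def intro!: eq_matI)
next
  case (Suc n)
  note A = Suc.prems(1)
  obtain v e where v: "v \<in> carrier_vec (Suc n)" "v \<bullet> v = 1" and e: "A *\<^sub>v v = e \<cdot>\<^sub>v v"
    using symmetric_real_eigenvector[OF Suc.prems] by auto
  obtain H where H: "H \<in> carrier_mat (Suc n) (Suc n)" "transpose_mat H = H" "H * H = 1\<^sub>m (Suc n)"
     "col H 0 = v"
    using householder[OF v] by auto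
  define B where "B = H * A * H"
  have B: "B \<in> carrier_mat (Suc n) (Suc n)" using H A by (simp add: B_def)
  have Bsym: "transpose_mat B = B"
    using H(1,2) A Suc.prems(2)
    by (simp add: B_def transpose_mult[of _ "Suc n" "Suc n" _ "Suc n"]
        assoc_mult_mat[of _ "Suc n" "Suc n" _ "Suc n" _ "Suc n"])
  have HBH: "H * B * H = A"
  proof -
    have "H * B * H = (H * H) * A * (H * H)"
      using H(1) A by (simp add: B_def assoc_mult_mat[of _ "Suc n" "Suc n" _ "Suc n" _ "Suc n"])
    then show ?thesis using H(3) A by simp
  qed
  note assoc = assoc_mult_mat[of _ "Suc n" "Suc n" _ "Suc n" _ "Suc n"]
  have "col B 0 = e \<cdot>\<^sub>v unit_vec (Suc n) 0"
  proof -
    have "col B 0 = (H * A) *\<^sub>v v"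
      unfolding B_def H(4)[symmetric] using H(1) A by (intro col_mult2) auto
    also have "\<dots> = e \<cdot>\<^sub>v (H *\<^sub>v v)"
      using H(1) A v(1) e smult_mult_mat_vec[OF H(1) v(1)] by simp
    also have "H *\<^sub>v v = col (H * H) 0"
      using H(1) H(4) col_mult2[OF H(1) H(1), of 0] by simp
    finally show ?thesis unfolding H(3) by simp
  qed
  then have col0: "B $$ (i, 0) = (if i = 0 then e else 0)" if "i < Suc n" for i
  proof -
    have "B $$ (i, 0) = col B 0 $ i" using that B by simp
    then show ?thesis using that unfolding \<open>col B 0 = _\<close> by simp
  qed
  have row0: "B $$ (0, i) = (if i = 0 then e else 0)" if "i < Suc n" for i
    using col0[OF that] that B index_transpose_mat(1)[of 0 B i] unfolding Bsym by simp
  define C where "C = mat n n (\<lambda>(i, j). B $$ (Suc i, Suc j))"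
  have C: "C \<in> carrier_mat n n" by (simp add: C_def)
  let ?E = "mat 1 1 (\<lambda>_. e)"
  let ?block = "\<lambda>X Y. four_block_mat X (0\<^sub>m 1 n) (0\<^sub>m n 1) Y"
  have B_block: "B = ?block ?E C"
  proof (rule eq_matI)
    fix i j assume "i < dim_row (?block ?E C)" "j < dim_col (?block ?E C)"
    then have "i < Suc n" "j < Suc n" by (auto simp: C_def)
    then show "B $$ (i, j) = ?block ?E C $$ (i, j)"
      using col0[of i] row0[of j] by (cases i; cases j) (auto simp: C_def)
  qed (use B in \<open>auto simp: C_def\<close>)
  have "transpose_mat C = C"
    using B index_transpose_mat(1)[of _ B] unfolding Bsym C_def by (intro eq_matI) auto
  from Suc.IH[OF C this] obtain Q D where QD: "Q \<in> carrier_mat n n" "D \<in> carrier_mat n n"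
     "diagonal_mat D" "transpose_mat Q * Q = 1\<^sub>m n" "C = Q * D * transpose_mat Q"
    by blast
  have mult_block: "?block X Y * ?block X' Y' = ?block (X * X') (Y * Y')"
    if "X \<in> carrier_mat 1 1" "X' \<in> carrier_mat 1 1" "Y \<in> carrier_mat n n" "Y' \<in> carrier_mat n n"
    for X X' Y Y' :: "real mat"
    using that by (subst mult_four_block_mat[OF that(1) _ _ that(3) that(2) _ _ that(4)]) auto
  have transpose_block: "transpose_mat (?block X Y) = ?block (transpose_mat X) (transpose_mat Y)"
    if "X \<in> carrier_mat 1 1" "Y \<in> carrier_mat n n" for X Y :: "real mat"
    using that by (subst transpose_four_block_mat[OF that(1) _ _ that(2)]) auto
  note blocks = mult_block[unfolded One_nat_def] transpose_block[unfolded One_nat_def]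
  define R where "R = ?block (1\<^sub>m 1) Q"
  define D' where "D' = ?block ?E D"
  have R: "R \<in> carrier_mat (Suc n) (Suc n)" and D': "D' \<in> carrier_mat (Suc n) (Suc n)"
    using four_block_carrier_mat[of "1\<^sub>m 1" 1 1 Q n n] four_block_carrier_mat[of ?E 1 1 D n n] QD(1,2)
    by (simp_all add: R_def D'_def)
  have RR: "transpose_mat R * R = 1\<^sub>m (Suc n)"
    using QD(1,4) by (simp add: R_def blocks)
  have B_eq: "B = R * D' * transpose_mat R"
    using QD by (simp add: R_def D'_def B_block blocks)
  have tr: "transpose_mat (H * R) = transpose_mat R * H"
    using H(1,2) R by (simp add: transpose_mult[of _ "Suc n" "Suc n" _ "Suc n"])
  show ?case
  proof (intro exI conjI)
    show "H * R \<in> carrier_mat (Suc n) (Suc n)" using H(1) R by simp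
    show "D' \<in> carrier_mat (Suc n) (Suc n)" by (rule D')
    show "diagonal_mat D'" using QD(2,3) by (auto simp: D'_def diagonal_mat_def)
    have "transpose_mat R * H * (H * R) = transpose_mat R * (H * H) * R"
      using H(1) R by (simp add: assoc)
    also have "\<dots> = 1\<^sub>m (Suc n)" unfolding H(3) using R RR by simp
    finally show "transpose_mat (H * R) * (H * R) = 1\<^sub>m (Suc n)" unfolding tr .
    have "H * R * D' * (transpose_mat R * H) = H * (R * D' * transpose_mat R) * H"
      using H(1) R D' by (simp add: assoc)
    then show "A = H * R * D' * transpose_mat (H * R)"
      unfolding tr B_eq[symmetric] HBH by simp
  qed
qed

section \<open>Signature and negative definite subspaces\<close>

lemma order_linear_factors:
  "Polynomial.order x (\<Prod>a\<leftarrow>xs. [:- a, 1:]) = count_list xs (x :: 'a :: idom)"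
proof (induction xs)
  case (Cons a xs)
  have "(\<Prod>a\<leftarrow>xs. [:- a, 1:]) \<noteq> 0" by (auto simp: prod_list_zero_iff)
  then have "Polynomial.order x ([:- a, 1:] * (\<Prod>a\<leftarrow>xs. [:- a, 1:])) =
      Polynomial.order x [:- a, 1:] + count_list xs x"
    using Cons.IH by (subst order_mult) (simp_all only: mult_eq_0_iff pCons_eq_0_iff one_neq_zero simp_thms)
  moreover have "Polynomial.order x [:- a, 1:] = (if a = x then 1 else 0)"
    by (auto simp: order_linear' order_0I)
  ultimately show ?case by simp
qed simp

lemma sum_count_list_filter:
  "(\<Sum>x | x \<in> set xs \<and> P x. int (count_list xs x)) = int (length (filter P xs))"
proof -
  have "(\<Sum>x | x \<in> set xs \<and> P x. int (count_list xs x)) =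
      (\<Sum>x\<in>set (filter P xs). int (count_list (filter P xs) x))"
    by (intro sum.cong) (auto simp: count_list_eq_length_filter intro!: arg_cong[where f = length] filter_cong)
  also have "\<dots> = int (length (filter P xs))"
    using sum_count_set[of "filter P xs" "set (filter P xs)"] by (simp flip: of_nat_sum)
  finally show ?thesis .
qed

lemma matrix_signature_diagonal:
  assumes A: "A \<in> carrier_mat n n" and cp: "char_poly A = (\<Prod>a\<leftarrow>xs. [:- a, 1:])"
  shows "matrix_signature A =
    int (length (filter (\<lambda>x. x > 0) xs)) - int (length (filter (\<lambda>x. x < 0) xs))"
proof -
  have "eigenvalue A x \<longleftrightarrow> x \<in> set xs" for x
    unfolding eigenvalue_root_char_poly[OF A] cp poly_prod_list by (auto simp: prod_list_zero_iff)
  then show ?thesis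
    unfolding matrix_signature_def cp order_linear_factors
    by (simp add: sum_count_list_filter)
qed

text \<open>One half of Sylvester's law. With fewer than \<open>card I\<close> negative eigenvalues,
  some nonzero vector supported in \<open>I\<close> would be orthogonal to all their eigenvectors,
  and the form would be nonnegative on it.\<close>

lemma matrix_signature_le:
  fixes A :: "real mat"
  assumes A: "A \<in> carrier_mat n n" and sym: "transpose_mat A = A" and I: "I \<subseteq> {..<n}"
    and neg: "\<And>v. v \<in> carrier_vec n \<Longrightarrow> v \<noteq> 0\<^sub>v n \<Longrightarrow> (\<And>i. i < n \<Longrightarrow> i \<notin> I \<Longrightarrow> v $ i = 0) \<Longrightarrow>
      v \<bullet> (A *\<^sub>v v) < 0"
  shows "matrix_signature A \<le> int n - 2 * int (card I)"
proof -
  obtain Q D where Q: "Q \<in> carrier_mat n n" and D: "D \<in> carrier_mat n n" "diagonal_mat D"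
    and QQ: "transpose_mat Q * Q = 1\<^sub>m n" and A_eq: "A = Q * D * transpose_mat Q"
    using symmetric_real_diagonalizable[OF A sym] by blast
  have QQ': "Q * transpose_mat Q = 1\<^sub>m n"
    using mat_mult_left_right_inverse[OF _ Q QQ] Q by simp
  define xs where "xs = diag_mat D"
  have "similar_mat A D"
    unfolding similar_mat_def similar_mat_wit_def Let_def
    using A Q D QQ QQ' A_eq by (intro exI[of _ Q] exI[of _ "transpose_mat Q"]) auto
  then have "char_poly A = char_poly D" by (rule char_poly_similar)
  also have "\<dots> = (\<Prod>a\<leftarrow>xs. [:- a, 1:])"
    unfolding xs_def by (rule char_poly_upper_triangular[OF D(1)])
      (use D in \<open>auto simp: diagonal_mat_def upper_triangular_def\<close>)
  finally have sig: "matrix_signature A =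
    int (length (filter (\<lambda>x. x > 0) xs)) - int (length (filter (\<lambda>x. x < 0) xs))"
    by (rule matrix_signature_diagonal[OF A])
  have len: "length xs = n" using D(1) by (simp add: xs_def diag_mat_def)
  define N where "N = filter (\<lambda>i. xs ! i < 0) [0..<n]"
  have lenN: "length (filter (\<lambda>x. x < 0) xs) = length N"
    unfolding N_def len[symmetric] by (subst (1) map_nth[symmetric]) (simp only: filter_map length_map o_def)
  have "card I \<le> length N"
  proof (rule ccontr)
    assume less: "\<not> card I \<le> length N"
    \<comment> \<open>The linear conditions on the vector: zero outside \<open>I\<close>, and
      orthogonal to the columns of \<open>Q\<close> that belong to negative eigenvalues.\<close>
    define rows where "rows = map (unit_vec n) (filter (\<lambda>i. i \<notin> I) [0..<n]) @ map (col Q) N"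
    have "length (filter (\<lambda>i. i \<notin> I) [0..<n]) = card ({..<n} - I)"
      by (subst distinct_card[symmetric]) (auto intro!: arg_cong[where f = card])
    also have "\<dots> = n - card I" using I by (simp add: card_Diff_subset finite_subset)
    finally have len_rows: "length rows < n"
      using less card_mono[OF _ I] by (simp add: rows_def)
    \<comment> \<open>Fewer than \<open>n\<close> conditions, padded by zero rows to a square
      matrix. Its last row is zero, so it has a nontrivial kernel.\<close>
    define M where "M = mat\<^sub>r n n (\<lambda>i. if i = n - 1 then 0\<^sub>v n else
      if i < length rows then rows ! i else 0\<^sub>v n)"
    have rows_carrier: "r \<in> carrier_vec n" if "r \<in> set rows" for r
      using that Q by (auto simp: rows_def)
    have M: "M \<in> carrier_mat n n" by (simp add: M_def)
    have "det M = 0"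
      unfolding M_def
    proof (rule det_row_0)
      show "n - 1 < n" using len_rows by simp
      show "(\<lambda>i. if i < length rows then rows ! i else 0\<^sub>v n) \<in> {0..<n} \<rightarrow> carrier_vec n"
        using rows_carrier by (intro Pi_I) simp
    qed
    from det_0_iff_vec_prod_zero[OF M, THEN iffD1, OF this]
    obtain v where v: "v \<in> carrier_vec n" "v \<noteq> 0\<^sub>v n" "M *\<^sub>v v = 0\<^sub>v n"
      by (elim exE conjE)
    have orth: "r \<bullet> v = 0" if r: "r \<in> set rows" for r
    proof -
      obtain i where i: "i < length rows" "rows ! i = r"
        using r unfolding in_set_conv_nth by blast
      have lt: "i < n" "i \<noteq> n - 1" using i(1) len_rows by linarith+
      have "row M i = r"
        unfolding M_def using lt i rows_carrier[OF r] by (subst row_mat_of_row_fun) auto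
      moreover have "(M *\<^sub>v v) $ i = row M i \<bullet> v" using lt(1) M by simp
      ultimately show ?thesis using v(3) lt(1) by simp
    qed
    have "v $ i = 0" if "i < n" "i \<notin> I" for i
      using orth[of "unit_vec n i"] that v(1) by (simp add: rows_def)
    then have "v \<bullet> (A *\<^sub>v v) < 0" using neg v by blast
    moreover have "v \<bullet> (A *\<^sub>v v) \<ge> 0"
    proof -
      define w where "w = transpose_mat Q *\<^sub>v v"
      have w: "w \<in> carrier_vec n"
        using mult_mat_vec_carrier[of "transpose_mat Q" n n v] Q v(1) by (simp add: w_def)
      have wi: "w $ i = col Q i \<bullet> v" if "i < n" for i using that Q by (simp add: w_def)
      have "A *\<^sub>v v = Q *\<^sub>v (D *\<^sub>v w)"
        using assoc_mult_mat_vec[of "Q * D" n n "transpose_mat Q" n v]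
          assoc_mult_mat_vec[of Q n n D n w] Q D(1) v(1) w
        unfolding A_eq w_def by simp
      then have "v \<bullet> (A *\<^sub>v v) = w \<bullet> (D *\<^sub>v w)"
        using transpose_vec_mult_scalar[of Q n n "D *\<^sub>v w" v] Q D(1) v(1) w
        by (simp add: w_def comm_scalar_prod[of _ n])
      also have "\<dots> = (\<Sum>i = 0..<n. w $ i * (D *\<^sub>v w) $ i)"
        using D(1) by (simp add: scalar_prod_def)
      also have "\<dots> = (\<Sum>i = 0..<n. xs ! i * (w $ i)\<^sup>2)"
      proof (rule sum.cong)
        fix i assume "i \<in> {0..<n}"
        then have i: "i < n" by simp
        have "(D *\<^sub>v w) $ i = (\<Sum>j = 0..<n. D $$ (i, j) * w $ j)"
          using i D(1) w by (simp add: scalar_prod_def)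
        also have "\<dots> = (\<Sum>j = 0..<n. if j = i then D $$ (i, i) * w $ i else 0)"
          using i D by (intro sum.cong) (auto simp: diagonal_mat_def)
        also have "\<dots> = xs ! i * w $ i" using i D(1) by (simp add: xs_def diag_mat_def)
        finally show "w $ i * (D *\<^sub>v w) $ i = xs ! i * (w $ i)\<^sup>2"
          by (simp add: power2_eq_square)
      qed simp
      also have "\<dots> \<ge> 0"
      proof (rule sum_nonneg)
        fix i assume "i \<in> {0..<n}"
        then have i: "i < n" by simp
        show "xs ! i * (w $ i)\<^sup>2 \<ge> 0"
        proof (cases "xs ! i < 0")
          case True
          then have "col Q i \<in> set rows" using i by (auto simp: rows_def N_def)
          then show ?thesis using orth wi[OF i] by simp
        qed simp
      qed
      finally show ?thesis .
    qed
    ultimately show False by simp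
  qed
  moreover have "length (filter (\<lambda>x. x > 0) xs) + length (filter (\<lambda>x. x < 0) xs) \<le> n"
    unfolding len[symmetric] by (induction xs) auto
  ultimately show ?thesis unfolding sig lenN by linarith
qed

section \<open>Column loops and the signature\<close>

text \<open>For a generator that does not occur, truncated subtraction gives the correct value
  0.\<close>

lemma length_column_loops:
  "length (filter (\<lambda>x. fst (w ! fst x) = i) (braid_loops w)) = count_list (map fst w) i - 1"
proof (induction w)
  case (Cons l w)
  have IH: "length (filter (\<lambda>x. fst ((l # w) ! fst x) = i) (map (map_prod Suc Suc) (braid_loops w))) =
      count_list (map fst w) i - 1"
    using Cons by (simp add: filter_map o_def)
  show ?case
  proof (cases "i \<in> fst ` set w")
    case True
    then have "count_list (map fst w) i \<noteq> 0" by (simp add: count_list_0_iff)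
    then show ?thesis
      unfolding braid_loops_Cons filter_append length_append IH using True by auto
  next
    case False
    then have "count_list (map fst w) i = 0" by (simp add: count_list_0_iff)
    then show ?thesis
      unfolding braid_loops_Cons filter_append length_append IH using False by auto
  qed
qed simp

text \<open>At \<open>t = - 1\<close> the coefficient \<open>1 + t\<close> within a column vanishes
  and the diagonal of column 1 is -1. On that column the form is therefore minus the dot product of
  the vectors \<open>e_a - e_b\<close>.\<close>

lemma loop_form_column_1:
  assumes "x \<in> set (braid_loops w)" "z \<in> set (braid_loops w)"
    and "fst (w ! fst x) = 1" "fst (w ! fst z) = 1"
  shows "loop_form (- 1) w x z = - (\<Sum>j<length w.
    (of_bool (fst x = j) - of_bool (snd x = j)) * (of_bool (fst z = j) - of_bool (snd z = j)))"
proof -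
  obtain a b c d where xz: "x = (a, b)" "z = (c, d)" by (cases x, cases z)
  have ab: "a < length w" "b < length w" "fst (w ! b) = 1" "fst (w ! a) = 1"
    and cd: "fst (w ! c) = 1" "fst (w ! d) = 1"
    using assms unfolding xz by (auto simp: set_braid_loops)
  have band: "band_form (- 1) w i k = - of_bool (i = k)" if "fst (w ! i) = 1" "fst (w ! k) = 1" for i k
    using that by (simp add: band_form_def diag_coeff_def lower_coeff_def)
  have "(\<Sum>j<length w. (of_bool (a = j) - of_bool (b = j)) * (of_bool (c = j) - of_bool (d = j)) :: real) =
      (\<Sum>j<length w. (if j = a then of_bool (a = c) - of_bool (a = d) else 0) -
        (if j = b then of_bool (b = c) - of_bool (b = d) else 0))"
    by (intro sum.cong) auto
  also have "\<dots> = of_bool (a = c) - of_bool (a = d) - (of_bool (b = c) - of_bool (b = d))"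
    using ab by (simp add: sum_subtractf)
  finally show ?thesis
    using ab cd by (simp add: xz loop_form_def band)
qed

text \<open>The vectors \<open>e_a - e_b\<close> of the first column are linearly independent, so
  the form is negative definite on the coordinate subspace of its loops.\<close>

lemma link_signature_le:
  assumes w: "alternating_letters w"
  shows "link_signature w \<le>
    int (length (braid_loops w)) - 2 * int (count_list (map fst w) 1 - 1)"
proof -
  define L where "L = braid_loops w"
  define n where "n = length L"
  define I where "I = {i. i < n \<and> fst (w ! fst (L ! i)) = 1}"
  let ?h = "loop_form (- 1) w"
  have nth: "L ! i \<in> set L" if "i < n" for i using that by (simp add: n_def)
  have A: "map_mat real_of_int (Seifert_matrix w + transpose_mat (Seifert_matrix w)) =
      list_mat L ?h"
  proof (rule eq_matI)
    fix i j assume "i < dim_row (list_mat L ?h)" "j < dim_col (list_mat L ?h)"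
    then have ij: "i < n" "j < n" by (simp_all add: list_mat_def n_def)
    then show "map_mat real_of_int (Seifert_matrix w + transpose_mat (Seifert_matrix w)) $$ (i, j) =
        list_mat L ?h $$ (i, j)"
      using loop_form_eq[OF w nth[OF ij(1), unfolded L_def] nth[OF ij(2), unfolded L_def], of "- 1"]
      by (simp add: Seifert_matrix_def Let_def list_mat_def n_def L_def)
  qed (simp_all add: Seifert_matrix_def Let_def list_mat_def L_def)
  have carrier: "list_mat L ?h \<in> carrier_mat n n" by (simp add: n_def)
  have swap: "?h x z = ?h z x" if "x \<in> set L" "z \<in> set L" for x z
    unfolding loop_form_eq[OF w that[unfolded L_def], symmetric]
      loop_form_eq[OF w that(2,1)[unfolded L_def], symmetric] by simp
  have sym: "transpose_mat (list_mat L ?h) = list_mat L ?h"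
  proof (rule eq_matI)
    fix i j assume "i < dim_row (list_mat L ?h)" "j < dim_col (list_mat L ?h)"
    then have ij: "i < n" "j < n" by (simp_all add: list_mat_def n_def)
    then show "transpose_mat (list_mat L ?h) $$ (i, j) = list_mat L ?h $$ (i, j)"
      using swap[OF nth[OF ij(1)] nth[OF ij(2)]] by (simp add: list_mat_def n_def)
  qed (simp_all add: list_mat_def)
  have neg: "v \<bullet> (list_mat L ?h *\<^sub>v v) < 0"
    if v: "v \<in> carrier_vec n" "v \<noteq> 0\<^sub>v n" and supp: "\<And>i. i < n \<Longrightarrow> i \<notin> I \<Longrightarrow> v $ i = 0" for v
  proof -
    define \<delta> :: "nat \<Rightarrow> nat \<Rightarrow> real"
      where "\<delta> i j = of_bool (fst (L ! i) = j) - of_bool (snd (L ! i) = j)" for i j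
    define y where "y j = (\<Sum>i<n. v $ i * \<delta> i j)" for j
    have "v \<bullet> (list_mat L ?h *\<^sub>v v) = (\<Sum>i<n. v $ i * (\<Sum>k<n. ?h (L ! i) (L ! k) * v $ k))"
      using v(1) by (simp add: scalar_prod_def list_mat_def n_def atLeast0LessThan)
    also have "\<dots> = (\<Sum>i<n. \<Sum>k<n. v $ i * v $ k * ?h (L ! i) (L ! k))"
      by (simp add: sum_distrib_left mult_ac)
    also have "\<dots> = (\<Sum>i<n. \<Sum>k<n. - (\<Sum>j<length w. (v $ i * \<delta> i j) * (v $ k * \<delta> k j)))"
    proof (intro sum.cong refl)
      fix i k assume ik: "i \<in> {..<n}" "k \<in> {..<n}"
      show "v $ i * v $ k * ?h (L ! i) (L ! k) = - (\<Sum>j<length w. (v $ i * \<delta> i j) * (v $ k * \<delta> k j))"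
      proof (cases "i \<in> I \<and> k \<in> I")
        case True
        then have "?h (L ! i) (L ! k) = - (\<Sum>j<length w. \<delta> i j * \<delta> k j)"
          using loop_form_column_1[of "L ! i" w "L ! k"] nth ik
          by (simp add: I_def \<delta>_def flip: L_def)
        then show ?thesis by (simp add: sum_distrib_left mult_ac)
      next
        case False
        then have "v $ i = 0 \<or> v $ k = 0" using supp ik by auto
        then show ?thesis by auto
      qed
    qed
    also have "\<dots> = - (\<Sum>i<n. \<Sum>k<n. \<Sum>j<length w. (v $ i * \<delta> i j) * (v $ k * \<delta> k j))"
      by (simp add: sum_negf)
    also have "(\<Sum>i<n. \<Sum>k<n. \<Sum>j<length w. (v $ i * \<delta> i j) * (v $ k * \<delta> k j)) =
        (\<Sum>i<n. \<Sum>j<length w. \<Sum>k<n. (v $ i * \<delta> i j) * (v $ k * \<delta> k j))"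
      by (intro sum.cong refl sum.swap)
    also have "\<dots> = (\<Sum>j<length w. \<Sum>i<n. \<Sum>k<n. (v $ i * \<delta> i j) * (v $ k * \<delta> k j))"
      by (rule sum.swap)
    also have "\<dots> = (\<Sum>j<length w. (y j)\<^sup>2)"
      by (simp add: y_def power2_eq_square sum_product)
    finally have eq: "v \<bullet> (list_mat L ?h *\<^sub>v v) = - (\<Sum>j<length w. (y j)\<^sup>2)" .
    have "\<exists>i. i < n \<and> v $ i \<noteq> 0"
    proof (rule ccontr)
      assume "\<not> ?thesis"
      then have "v = 0\<^sub>v n" using v(1) by (intro eq_vecI) auto
      then show False using v(2) by simp
    qed
    \<comment> \<open>Among the loops of nonzero weight, one with the earliest first band is the
      only one that meets this band, so the weight survives in \<open>y a\<close>.\<close>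
    then obtain i where i: "i < n" "v $ i \<noteq> 0"
      and min: "\<And>k. k < n \<Longrightarrow> v $ k \<noteq> 0 \<Longrightarrow> fst (L ! i) \<le> fst (L ! k)"
      using ex_has_least_nat[of "\<lambda>i. i < n \<and> v $ i \<noteq> 0" _ "\<lambda>i. fst (L ! i)"] by blast
    define a where "a = fst (L ! i)"
    have loop: "fst (L ! k) < snd (L ! k)" "snd (L ! k) < length w" if "k < n" for k
      using nth[OF that] set_braid_loops[of "fst (L ! k)" "snd (L ! k)" w] by (simp_all add: L_def)
    have "y a = (\<Sum>k<n. if k = i then v $ i else 0)"
      unfolding y_def
    proof (intro sum.cong refl)
      fix k assume k: "k \<in> {..<n}"
      show "v $ k * \<delta> k a = (if k = i then v $ i else 0)"
      proof (cases "k = i \<or> v $ k = 0")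
        case True
        then show ?thesis using loop(1)[OF i(1)] by (auto simp: \<delta>_def a_def)
      next
        case False
        then have "a \<le> fst (L ! k)" "fst (L ! k) < snd (L ! k)"
          using min[of k] loop(1)[of k] k by (auto simp: a_def)
        moreover have "fst (L ! k) \<noteq> a"
        proof
          assume eq: "fst (L ! k) = a"
          have "(fst (L ! k), snd (L ! k)) \<in> set L" "(fst (L ! i), snd (L ! i)) \<in> set L"
            using nth k i(1) by simp_all
          from braid_loops_trichotomy[OF this[unfolded L_def]]
          have "fst (L ! k) = fst (L ! i) \<and> snd (L ! k) = snd (L ! i) \<or>
              snd (L ! k) \<le> fst (L ! i) \<or> snd (L ! i) \<le> fst (L ! k)"
            using eq by (simp add: a_def L_def)
          moreover have "fst (L ! k) < snd (L ! k)" "fst (L ! i) < snd (L ! i)"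
            using loop(1) k i(1) by simp_all
          ultimately have "L ! k = L ! i"
            using eq unfolding a_def by (intro prod_eqI) linarith+
          moreover have "distinct L" "k < length L" "i < length L"
            using k i(1) by (simp_all add: distinct_braid_loops L_def n_def)
          ultimately have "k = i" using nth_eq_iff_index_eq by blast
          then show False using False by blast
        qed
        ultimately show ?thesis using False by (auto simp: \<delta>_def)
      qed
    qed
    then have "y a = v $ i" using i(1) by simp
    then have "(y a)\<^sup>2 > 0" using i(2) by simp
    moreover have "a < length w" using loop[OF i(1)] by (simp add: a_def)
    ultimately have "(\<Sum>j<length w. (y j)\<^sup>2) > 0"
      by (intro sum_pos2[of _ a]) auto
    then show ?thesis unfolding eq by simp
  qed
  have "I \<subseteq> {..<n}" by (auto simp: I_def)
  then have "matrix_signature (list_mat L ?h) \<le> int n - 2 * int (card I)"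
    using neg by (rule matrix_signature_le[OF carrier sym])
  moreover have "card I = count_list (map fst w) 1 - 1"
    using length_column_loops[of w 1] unfolding I_def n_def L_def length_filter_conv_card .
  moreover have "link_signature w = matrix_signature (list_mat L ?h)"
    unfolding link_signature_def Let_def A ..
  ultimately show ?thesis unfolding n_def L_def by (simp only:)
qed

section \<open>The Hirasawa--Murasugi conjecture\<close>

lemma coeff_sum_monom:
  "coeff (\<Sum>i<l. monom (c i) i) m = (if m < l then c m else (0 :: int))"
  by (simp add: coeff_sum sum.delta)

text \<open>Both polynomials have nonzero constant coefficient, so a unit relating them is a sign.
  Absolute values of coefficients then recover \<open>a\<close>, and the degree recovers
  \<open>l\<close>.\<close>

lemma alternating_coeffs_iff:
  assumes F: "\<And>i. F i = s * (- 1) ^ i * coeff f i" and s: "s \<in> {1, - 1}"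
    and pos: "\<And>i. i \<le> N \<Longrightarrow> F i > 0" and zero: "\<And>i. i > N \<Longrightarrow> F i = 0"
  shows "alternating_coeffs f l a \<longleftrightarrow> l = Suc N \<and> (\<forall>i<l. a i = F i)"
proof
  define S where "S = (\<Sum>i<l. monom ((- 1) ^ i * a i) i)"
  have coeff_S: "coeff S m = (if m < l then (- 1) ^ m * a m else 0)" for m
    by (simp add: S_def coeff_sum_monom)
  have abs_F: "\<bar>coeff f i\<bar> = F i" for i
  proof -
    have "\<bar>F i\<bar> = \<bar>coeff f i\<bar>" using s by (auto simp: F abs_mult)
    moreover have "F i \<ge> 0" using pos[of i] zero[of i] by (cases "i \<le> N") auto
    ultimately show ?thesis by simp
  qed
  {
    assume "alternating_coeffs f l a"
    then have l: "l \<ge> 1" "\<And>i. i < l \<Longrightarrow> a i \<ge> 0" "a 0 \<noteq> 0" "a (l - 1) \<noteq> 0" and "f \<doteq> S"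
      by (auto simp: alternating_coeffs_def S_def)
    then obtain j k e where e: "e \<in> {1, - 1}" and eq: "monom 1 j * f = monom e k * S"
      by (auto simp: eq_up_to_units_def)
    have eq_coeff: "(if j \<le> m then coeff f (m - j) else 0) = (if k \<le> m then e * coeff S (m - k) else 0)"
      for m
      using arg_cong[OF eq, of "\<lambda>p. coeff p m"] by (simp only: coeff_monom_mult mult_1_left)
    have "coeff f 0 \<noteq> 0" using abs_F[of 0] pos[of 0] by auto
    then have "k \<le> j" using eq_coeff[of j] by (auto split: if_splits)
    moreover have "coeff S 0 \<noteq> 0" using l by (auto simp: coeff_S)
    then have "j \<le> k" using eq_coeff[of k] e by (auto split: if_splits)
    ultimately have "coeff f i = e * coeff S i" for i
      using eq_coeff[of "i + j"] by simp
    then have abs_S: "F i = (if i < l then a i else 0)" for i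
      using e l(2)[of i] by (auto simp flip: abs_F simp: abs_mult coeff_S)
    have "l - 1 \<le> N" using zero[of "l - 1"] abs_S[of "l - 1"] l by (cases "l - 1 \<le> N") auto
    moreover have "N < l" using pos[of N] abs_S[of N] by (auto split: if_splits)
    ultimately show "l = Suc N \<and> (\<forall>i<l. a i = F i)" using abs_S by auto
  }
  assume a: "l = Suc N \<and> (\<forall>i<l. a i = F i)"
  have "f = monom s 0 * S"
  proof (rule poly_eqI)
    fix i
    have "s * s = 1" using s by auto
    moreover have "(- 1 :: int) ^ i * (- 1) ^ i = 1" by (simp flip: power_mult_distrib)
    moreover have "s * ((- 1) ^ i * F i) = (s * s) * ((- 1) ^ i * (- 1) ^ i) * coeff f i"
      unfolding F by (simp only: mult_ac)
    ultimately have "s * ((- 1) ^ i * F i) = coeff f i" by simp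
    then show "coeff f i = coeff (monom s 0 * S) i"
      using a zero[of i] by (auto simp: coeff_monom_mult coeff_S)
  qed
  then have "monom 1 0 * f = monom s 0 * S" by simp
  then have "f \<doteq> S" using s unfolding eq_up_to_units_def by blast
  moreover have "F 0 \<noteq> 0" "F N \<noteq> 0" using pos[of 0] pos[of N] by simp_all
  ultimately show "alternating_coeffs f l a"
    using a pos unfolding alternating_coeffs_def S_def
    by (simp add: less_imp_le less_Suc_eq_le)
qed

text \<open>For \<open>i0 = Suc d\<close> and \<open>l = Suc N\<close> the corners of the trapezoid
  are \<open>d\<close> and \<open>N - d\<close>; the descent mirrors the ascent.\<close>

lemma trapezoidal_atI:
  fixes F a :: "nat \<Rightarrow> int"
  assumes a: "\<And>i. i \<le> N \<Longrightarrow> a i = F i" and d: "2 * d \<le> N"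
    and inc: "\<And>i. i < d \<Longrightarrow> F i < F (Suc i)"
    and const: "\<And>i. d \<le> i \<Longrightarrow> i \<le> N - d \<Longrightarrow> F i = F d"
    and sym: "\<And>i. i \<le> N \<Longrightarrow> F (N - i) = F i"
  shows "trapezoidal_at (Suc d) (Suc N) a"
proof -
  have mono: "F i < F j" if "i < j" "j \<le> d" for i j
    using that
  proof (induction j)
    case (Suc j)
    then show ?case using inc[of j] by (cases "i = j") auto
  qed simp
  have "strict_mono_on {0..d} a"
    using d mono by (intro strict_mono_onI) (simp add: a)
  moreover have "a i = a d" if "i \<in> {d..N - d}" for i
    using that d const[of i] a[of i] a[of d] by auto
  moreover have "strict_antimono_on {N - d..N} a"
  proof (rule monotone_onI)
    fix i j assume ij: "i \<in> {N - d..N}" "j \<in> {N - d..N}" "i < j"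
    then have "F (N - j) < F (N - i)" using d by (intro mono) auto
    then show "a i > a j"
      using ij a[of i] a[of j] sym[of i] sym[of j] by simp
  qed
  ultimately show ?thesis unfolding trapezoidal_at_def diff_Suc_1 diff_Suc_Suc by blast
qed

text \<open>Separates the long first block, so that \<open>u\<close> has exactly the length that the
  hypothesis of the theorem bounds.\<close>

lemma alternating_3braid_split:
  assumes n: "n \<ge> 1" and q: "\<forall>j\<in>{1..n}. q j > 0"
  obtains u where "alternating_3braid n p q = replicate (p 1) (1, 1) @ u"
    "alternating_letters u" "u \<noteq> []" "last u = (2, - 1)"
    "count_list (map fst u) 2 = (\<Sum>j=1..n. q j)"
    "length u = (\<Sum>i=2..n. p i) + (\<Sum>j=1..n. q j)"
proof -
  define block where "block i = replicate (p i) (1 :: nat, 1 :: int) @ replicate (q i) (2, - 1)" for i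
  define u where "u m = replicate (q 1) (2, - 1) @ concat (map block [2..<Suc m])" for m
  have gen: "gen_power 1 (int (p i)) @ gen_power 2 (- int (q i)) = block i" for i
    by (auto simp: gen_power_def block_def sgn_if)
  have "alternating_3braid n p q = replicate (p 1) (1, 1) @ u n"
  proof -
    have "[1..<Suc n] = 1 # [2..<Suc n]" using n by (simp add: upt_conv_Cons numeral_2_eq_2)
    then show ?thesis unfolding alternating_3braid_def gen u_def
      by (simp add: block_def[of "Suc 0"] del: upt_Suc)
  qed
  moreover have "alternating_letters (u n)"
    by (auto simp: alternating_letters_def u_def block_def)
  \<comment> \<open>The induction runs over truncations of the braid after \<open>m\<close> blocks,
    each again ending in a letter of generator 2.\<close>
  moreover have "u m \<noteq> [] \<and> last (u m) = (2, - 1) \<and>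
      count_list (map fst (u m)) 2 = (\<Sum>j=1..m. q j) \<and>
      length (u m) = (\<Sum>i=2..m. p i) + (\<Sum>j=1..m. q j)" if "1 \<le> m" "m \<le> n" for m
    using that
  proof (induction m rule: dec_induct)
    have count_same: "count_list (map fst (replicate k (i, e))) j = (if i = j then k else 0)"
      for k i j :: nat and e :: int
      by (induction k) auto
    {
      case base
      then show ?case using q n by (auto simp: u_def count_same[simplified] last_replicate)
    next
      case (step m)
      have "u (Suc m) = u m @ block (Suc m)" using step.hyps by (simp add: u_def)
      moreover have "q (Suc m) > 0" using q step by auto
      ultimately show ?case
        using step by (auto simp: block_def count_same[simplified] last_replicate)
    }
  qed
  ultimately show ?thesis using that[of "u n"] n by auto
qed

theorem theorem3p9:
  fixes n :: nat and p q :: "nat \<Rightarrow> nat"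
  assumes "n \<ge> 1"
    and "\<forall>i\<in>{1..n}. p i > 0"
    and "\<forall>j\<in>{1..n}. q j > 0"
    and "p 1 \<ge> (\<Sum>i=2..n. p i) + (\<Sum>j=1..n. q j) + 6"
  shows "Hirasawa_Murasugi (alternating_3braid n p q)"
proof -
  define w where "w = alternating_3braid n p q"
  define Q where "Q = (\<Sum>j=1..n. q j)"
  obtain u where u: "w = replicate (p 1) (1, 1) @ u" "alternating_letters u" "u \<noteq> []"
    "last u = (2, - 1)" "count_list (map fst u) 2 = Q" "length u = (\<Sum>i=2..n. p i) + Q"
    using alternating_3braid_split[OF assms(1,3)] unfolding w_def Q_def by blast
  have p: "length u + 6 \<le> p 1" using assms(4) u(6) by (simp add: Q_def)
  define P where "P = count_list (map fst w) 1"
  define N where "N = length (braid_loops w)"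
  define F where "F i = (- 1) ^ Suc P * (- 1) ^ i * coeff (Alexander_polynomial w) i" for i
  obtain d where d: "Q \<le> Suc d" "d < length u" "N + 2 = p 1 + length u"
    and F: "\<And>i. i \<le> N \<Longrightarrow> F i > 0" "\<And>i. i > N \<Longrightarrow> F i = 0"
    "\<And>i. i < d \<Longrightarrow> F i < F (Suc i)" "\<And>i. d \<le> i \<Longrightarrow> i \<le> N - d \<Longrightarrow> F i = F d"
    "\<And>i. i \<le> N \<Longrightarrow> F (N - i) = F i"
    using Alexander_polynomial_coeffs[OF u(2-4) p] unfolding u(1)[symmetric] u(5) N_def F_def P_def
    by blast
  have w: "alternating_letters w" using u(1,2) by (auto simp: alternating_letters_def)
  have PQ: "P + Q = p 1 + length u" "p 1 \<le> P"
  proof -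
    have "set (map fst u) \<subseteq> {1, 2}" using u(2) by (auto simp: alternating_letters_def)
    then have "count_list (map fst u) 1 + count_list (map fst u) 2 = length u"
      using sum_count_set[of "map fst u" "{1, 2}"] by simp
    moreover have "count_list (replicate k (1 :: nat)) 1 = k" for k by (induction k) auto
    then have "P = p 1 + count_list (map fst u) 1" by (simp add: P_def u(1))
    ultimately show "P + Q = p 1 + length u" "p 1 \<le> P" using u(5) by simp_all
  qed
  \<comment> \<open>As \<open>N = P + Q - 2\<close>, the upper bound \<open>N - 2 * (P - 1)\<close>
    for the signature is \<open>Q - P\<close>.\<close>
  have sig: "\<bar>link_signature w\<bar> \<ge> int P - int Q"
    using link_signature_le[OF w] PQ d(3) p unfolding N_def[symmetric] P_def[symmetric] by linarith
  have iff: "alternating_coeffs (Alexander_polynomial w) l a \<longleftrightarrow> l = Suc N \<and> (\<forall>i<l. a i = F i)" for l a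
  proof (rule alternating_coeffs_iff)
    show "(- 1) ^ Suc P \<in> {1, - 1 :: int}" by (cases "even P") auto
  qed (fact F_def F(1) F(2))+
  \<comment> \<open>The ascent and the descent do not overlap, since \<open>d < length u\<close> and
    \<open>N\<close> is at least \<open>2 * length u + 4\<close>.\<close>
  have d2: "2 * d \<le> N" using d p by linarith
  show ?thesis
    unfolding Hirasawa_Murasugi_def w_def[symmetric] iff
  proof (intro conjI allI impI)
    show "\<exists>l a. l = Suc N \<and> (\<forall>i<l. a i = F i)" by blast
    fix l a assume la: "l = Suc N \<and> (\<forall>i<l. a i = F i)"
    have "trapezoidal_at (Suc d) (Suc N) a"
    proof (rule trapezoidal_atI)
      show "a i = F i" if "i \<le> N" for i using la that by simp
    qed (fact d2 F(3) F(4) F(5))+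
    \<comment> \<open>The numerator on the right is \<open>N + 1 - 2 * d\<close>; with
      \<open>d >= Q - 1\<close> it is at most \<open>P - Q + 1\<close>.\<close>
    moreover have "(\<bar>link_signature w\<bar> + 1) div 2 \<ge> (int (Suc N) - 2 * (int (Suc d) - 1)) div 2"
      using sig PQ(1) d(1,3) by (intro zdiv_mono1) auto
    moreover have "Suc d \<in> {1..Suc N div 2 + 1}" using d2 by auto
    ultimately show "\<exists>i0\<in>{1..l div 2 + 1}. trapezoidal_at i0 l a \<and>
        (\<bar>link_signature w\<bar> + 1) div 2 \<ge> (int l - 2 * (int i0 - 1)) div 2"
      using la by blast
  qed
qed

end
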